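(* Let $q, a, b, c, d, z$ be complex numbers with $0<|q|<1$, $|cd/ab|<|z|<1$ and $|bq/d|<1$, such that no denominator occurring below vanishes. Then \begin{align*} {}_{2}\psi_2\left[\begin{array}{cc} a,&b\\ c,& d \end{array};q,z\right] ={}&\frac{(c/b,\,abz/d,\,dq/abz,\,q/d,\,q;q)_\infty}{(c,\,az/d,\,q/a,\,q/b,\,cd/abz;q)_\infty}\; {}_{2}\phi_{1}\left[\begin{array}{cc} cd/abz,&d/a\\ & dq/az \end{array};q,\frac{bq}{d}\right]\\ &-\frac{(cq/d,\,b,\,d/a,\,az/q,\,q^2/az,\,q/d,\,q;q)_\infty}{(d/q,\,c,\,bq/d,\,az/d,\,dq/az,\,q^2/d,\,q/a;q)_\infty}\; {}_{2}\phi_{1}\left[\begin{array}{cc} aq/d,&bq/d\\ &cq/d \end{array};q,z\right]. \end{align*}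
   Context: For $|q|<1$, $(x;q)_\infty=\prod_{k=0}^{\infty}(1-xq^k)$ and $(x;q)_n=(x;q)_\infty/(xq^n;q)_\infty$ for every integer $n$ (so $(x;q)_{-k}=1/(xq^{-k};q)_k$ for nonnegative integers $k$). For $n$ an integer or $\infty$, $(x_1,\ldots,x_m;q)_n=(x_1;q)_n\cdots(x_m;q)_n$. Inside such symbols, an expression like $dq/abz$ means $dq/(abz)$. The unilateral series is ${}_{2}\phi_1\left[\begin{array}{cc} x,&y\\ &w\end{array};q,t\right]=\sum_{k=0}^{\infty}\frac{(x,y;q)_k}{(q,w;q)_k}t^k$. The bilateral series is ${}_{2}\psi_2\left[\begin{array}{cc} x,&y\\ u,&w\end{array};q,t\right]=\sum_{k=-\infty}^{\infty}\frac{(x,y;q)_k}{(u,w;q)_k}t^k$. As usual, parameters are assumed to be such that all quantities and all terms of the series are well defined (no zero denominators). *)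

theory Defs
  imports "HOL-Analysis.Analysis"
begin

definition qpoch_inf :: "complex \<Rightarrow> complex \<Rightarrow> complex"
  where "qpoch_inf x q = (\<Prod>k. 1 - x * q ^ k)"

text \<open>
  The symbol \<open>(x;q)\<^sub>n\<close> for an integer \<open>n\<close>.  The quotient
  \<open>(x;q)\<^sub>\<infinity> / (x q\<^sup>n;q)\<^sub>\<infinity>\<close> takes the form \<open>0 / 0\<close> for some arguments
  (for instance \<open>x = 1\<close>, \<open>n = 0\<close>), where it stands for the finite product that is left after
  cancelling the common factors.  That finite product is taken as the definition; the lemma
  \<open>qpoch_eq_quotient\<close> below recovers the quotient.
  If \<open>(x;q)\<^sub>n\<close> with \<open>n < 0\<close> has a pole (\<open>x = q\<^sup>j\<close> with \<open>1 \<le> j \<le> - n\<close>), the value is \<open>0\<close>,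
  and so is the value of a fraction with \<open>(x;q)\<^sub>n\<close> as its denominator, in agreement with the
  usual convention that such a fraction vanishes.
\<close>
definition qpoch :: "complex \<Rightarrow> complex \<Rightarrow> int \<Rightarrow> complex"
  where "qpoch x q n =
    (if n \<ge> 0 then \<Prod>k<nat n. 1 - x * q ^ k
     else 1 / (\<Prod>k<nat (- n). 1 - x * q powi n * q ^ k))"

definition qpochs_inf :: "complex list \<Rightarrow> complex \<Rightarrow> complex"
  where "qpochs_inf xs q = (\<Prod>x\<leftarrow>xs. qpoch_inf x q)"

definition qpochs :: "complex list \<Rightarrow> complex \<Rightarrow> int \<Rightarrow> complex"
  where "qpochs xs q n = (\<Prod>x\<leftarrow>xs. qpoch x q n)"

definition phi21 :: "complex \<Rightarrow> complex \<Rightarrow> complex \<Rightarrow> complex \<Rightarrow> complex \<Rightarrow> complex"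
  where "phi21 x y w q t =
    (\<Sum>k::nat. qpochs [x, y] q (int k) / qpochs [q, w] q (int k) * t ^ k)"

definition psi22 :: "complex \<Rightarrow> complex \<Rightarrow> complex \<Rightarrow> complex \<Rightarrow> complex \<Rightarrow> complex \<Rightarrow> complex"
  where "psi22 x y u w q t =
    (\<Sum>\<^sub>\<infinity>k::int. qpochs [x, y] q k / qpochs [u, w] q k * t powi k)"

lemma convergent_prod_qpoch:
  assumes "norm q < 1"
  shows "convergent_prod (\<lambda>k. 1 - x * q ^ k :: complex)"
proof -
  have "summable (\<lambda>k. norm x * norm q ^ k)"
    using assms by (intro summable_mult summable_geometric) auto
  hence "summable (\<lambda>k. norm ((1 - x * q ^ k) - 1))"
    by (simp add: norm_mult norm_power)
  thus ?thesis
    by (intro abs_convergent_prod_imp_convergent_prod summable_imp_abs_convergent_prod)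
qed

lemma qpoch_inf_split:
  assumes "norm q < 1"
  shows "qpoch_inf x q = qpoch_inf (x * q ^ n) q * (\<Prod>k<n. 1 - x * q ^ k)"
proof (cases "\<exists>k<n. 1 - x * q ^ k = 0")
  case True
  then obtain k where k: "k < n" "1 - x * q ^ k = 0" by blast
  have "qpoch_inf x q = 0"
    unfolding qpoch_inf_def
    using has_prod_eq_0_iff[OF convergent_prod_has_prod[OF convergent_prod_qpoch[OF assms, of x]]] k(2)
    by (metis rangeI)
  moreover have "(\<Prod>k<n. 1 - x * q ^ k) = 0"
    using k by (intro prod_zero) auto
  ultimately show ?thesis by simp
next
  case False
  have "qpoch_inf x q = (\<Prod>i. 1 - x * q ^ (i + n)) * (\<Prod>i<n. 1 - x * q ^ i)"
    unfolding qpoch_inf_def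
    by (intro prodinf_split_initial_segment convergent_prod_qpoch assms) (use False in auto)
  thus ?thesis
    unfolding qpoch_inf_def by (simp add: power_add mult_ac)
qed

lemma qpoch_eq_quotient:
  assumes "norm q < 1" "q \<noteq> 0" "qpoch_inf (x * q powi n) q \<noteq> 0"
  shows "qpoch x q n = qpoch_inf x q / qpoch_inf (x * q powi n) q"
proof (cases "n \<ge> 0")
  case True
  then obtain m where m: "n = int m" using nonneg_int_cases by blast
  show ?thesis
    using qpoch_inf_split[OF assms(1), of x m] assms(3) by (simp add: qpoch_def m)
next
  case False
  define m where "m = nat (- n)"
  have n: "n = - int m" "nat (- n) = m" using False by (auto simp: m_def)
  have "x * q powi n * q ^ m = x"
    using assms(2) by (simp add: n(1) power_int_minus)
  hence "qpoch_inf (x * q powi n) q =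
           qpoch_inf x q * (\<Prod>k<m. 1 - x * q powi n * q ^ k)"
    using qpoch_inf_split[OF assms(1), of "x * q powi n" m] by metis
  thus ?thesis
    using False assms(3) by (simp add: qpoch_def n(2))
qed

end

theory Submission
  imports Defs
begin

text \<open>
  Put \<open>x = a z / d\<close>, \<open>p = q / d\<close>, \<open>v = q / a\<close> and write \<open>Q y\<close> for \<open>(y;q)\<^sub>\<infinity>\<close>.  Up to a
  constant, the \<open>k\<close>-th term of the bilateral series is
  \<open>x\<^sup>k Q (c q\<^sup>k) Q (v q\<^bsup>-k\<^esup>) f\<^sub>k\<close> with \<open>f\<^sub>k = (b;q)\<^sub>k / Q (p q\<^bsup>-k\<^esup>)\<close>.  The coefficients \<open>f\<^sub>k\<close> decay like
  \<open>q\<^bsup>k\<^sup>2/2\<^esup>\<close> in both directions, so that \<open>\<psi> y = \<Sum>\<^sub>k f\<^sub>k y\<^sup>k\<close> converges for every \<open>y \<noteq> 0\<close>.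
  Expanding the two products \<open>Q (c q\<^sup>k)\<close> and \<open>Q (v q\<^bsup>-k\<^esup>)\<close> by Euler's series turns the bilateral
  series into a double sum over \<open>m, n\<close> of the values \<open>\<psi> (x q\<^bsup>m-n\<^esup>)\<close>.
  
  The function \<open>\<psi>\<close> has a closed form (\<open>psi_formula\<close>): with the theta function
  \<open>\<theta> y = \<Sum>\<^sub>j (-1)\<^sup>j q\<^bsup>j(j-1)/2\<^esup> y\<^sup>j\<close> and one entire series \<open>\<Phi>\<close>, the product \<open>\<theta> y \<psi> y\<close> is a linear
  combination of \<open>\<theta> (b y) \<Phi> (1/y)\<close> and \<open>y \<theta> (p/y) \<Phi> y\<close>.  The quotients \<open>\<theta> (b y) / \<theta> y\<close> and
  \<open>y \<theta> (p/y) / \<theta> y\<close> pick up only the powers \<open>b\<^bsup>-j\<^esup>\<close> and \<open>p\<^sup>j\<close> under \<open>y \<mapsto> y q\<^sup>j\<close>, so the sum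
  over \<open>m, n\<close> can be done by Euler's series again (\<open>psi_product_sum\<close>).  It leaves two unilateral
  series.  The first becomes the first \<open>\<^sub>2\<phi>\<^sub>1\<close> by a Heine transformation (\<open>heine_sum\<close>), the second
  is the other \<open>\<^sub>2\<phi>\<^sub>1\<close> term by term (\<open>second_sum\<close>), and the triple product identity converts the
  theta functions into the products of the statement.
  
  The closed form of \<open>\<psi>\<close> comes from the partial fraction expansion of \<open>1 / (Q \<beta> Q u)\<close>
  (\<open>pfrac_has_sum\<close>), which is proved by iterating a telescoping recurrence in \<open>\<beta>\<close> and \<open>u\<close>.  It
  expresses \<open>f\<^sub>k\<close> through simple fractions \<open>1 / (1 - b q\<^bsup>k+i\<^esup>)\<close> and \<open>1 / (1 - p q\<^bsup>i-k\<^esup>)\<close>.  Multiplying by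
  \<open>\<theta>\<close> convolves these with the theta coefficients, and such a convolution is again a theta
  coefficient (\<open>tau_div_has_sum\<close>), as the same partial fraction expansion with \<open>\<beta> u = q\<close> shows.
  If \<open>b = q\<^bsup>-m\<^esup>\<close>, where \<open>Q (b q\<^sup>k)\<close> vanishes for \<open>k \<le> m\<close>, the series \<open>\<psi>\<close> breaks off at \<open>k = m\<close> and is
  compared with \<open>\<Phi>\<close> directly.
  
  Every interchange of summations is between absolutely convergent families.  For the multiple
  series with Euler expansions this rests on one majorant (\<open>summable_on_gauss_triple\<close>), and there
  \<open>norm z < 1\<close> and \<open>norm (c d / (a b)) < norm z\<close> enter.
\<close>

section \<open>Unconditional sums over products and over the integers\<close>

(* The notion of Infinite_Sum is the one used below. *)
no_notation Infinite_Set_Sum.abs_summable_on (infix "abs'_summable'_on" 50)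

text \<open>
  Interchange of summation in the form used to evaluate a series: the sums of the other
  iteration are known, and no explicit inner infinite sums appear.
\<close>

lemma has_sum_fubini:
  fixes f :: "'a \<times> 'b \<Rightarrow> complex"
  assumes "f abs_summable_on UNIV"
    and "\<And>x. ((\<lambda>y. f (x, y)) has_sum g x) UNIV"
    and "\<And>y. ((\<lambda>x. f (x, y)) has_sum h y) UNIV"
    and "(h has_sum S) UNIV"
  shows "(g has_sum S) UNIV"
proof -
  have 1: "f summable_on UNIV \<times> UNIV"
    using abs_summable_summable[OF assms(1)] by simp
  have "((\<lambda>(y, x). f (x, y)) has_sum S) (UNIV \<times> UNIV)"
    by (rule has_sum_SigmaI[where g = h])
       (use assms(3,4) summable_on_swap[of f UNIV UNIV] 1 in \<open>auto simp: case_prod_unfold\<close>)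
  hence "(f has_sum S) (UNIV \<times> UNIV)"
    by (subst has_sum_swap)
  from has_sum_SigmaD[OF this assms(2)] show ?thesis by simp
qed

lemma abs_summable_on_int:
  fixes f :: "int \<Rightarrow> 'a :: real_normed_vector"
  assumes "(\<lambda>n::nat. f (int n)) abs_summable_on UNIV" "(\<lambda>n::nat. f (- int n)) abs_summable_on UNIV"
  shows "f abs_summable_on UNIV"
proof -
  have 1: "f abs_summable_on (range int)"
    by (subst summable_on_reindex) (use assms(1) in \<open>auto simp: o_def\<close>)
  have 2: "f abs_summable_on (range (\<lambda>n. - int n))"
    by (subst summable_on_reindex) (use assms(2) in \<open>auto simp: o_def inj_on_def\<close>)
  have "UNIV = range int \<union> range (\<lambda>n. - int n)"
  proof (intro equalityI subsetI)
    fix k :: int show "k \<in> range int \<union> range (\<lambda>n. - int n)"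
      by (cases k rule: int_cases2) auto
  qed auto
  with summable_on_union[OF 1 2] show ?thesis by metis
qed

lemma abs_summable_on_int_prod:
  fixes f :: "int \<times> 'b \<Rightarrow> 'a :: real_normed_vector"
  assumes "(\<lambda>(n::nat, z). f (int n, z)) abs_summable_on UNIV"
    "(\<lambda>(n::nat, z). f (- int n, z)) abs_summable_on UNIV"
  shows "f abs_summable_on UNIV"
proof -
  have 1: "f abs_summable_on (range (map_prod int id))"
    by (subst summable_on_reindex)
       (use assms(1) in \<open>auto simp: o_def inj_on_def map_prod_def case_prod_unfold\<close>)
  have 2: "f abs_summable_on (range (map_prod (\<lambda>n. - int n) id))"
    by (subst summable_on_reindex)
       (use assms(2) in \<open>auto simp: o_def inj_on_def map_prod_def case_prod_unfold\<close>)
  have "UNIV = range (map_prod int id) \<union> range (map_prod (\<lambda>n. - int n) (id :: 'b \<Rightarrow> 'b))"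
  proof (intro equalityI subsetI)
    fix k :: "int \<times> 'b"
    obtain i z where k: "k = (i, z)" by (cases k)
    show "k \<in> range (map_prod int id) \<union> range (map_prod (\<lambda>n. - int n) id)"
    proof (cases i rule: int_cases2)
      case (nonneg n)
      hence "k = map_prod int id (n, z)" by (simp add: k)
      thus ?thesis by blast
    next
      case (nonpos n)
      hence "k = map_prod (\<lambda>n. - int n) id (n, z)" by (simp add: k)
      thus ?thesis by blast
    qed
  qed auto
  with summable_on_union[OF 1 2] show ?thesis by metis
qed

lemma abs_summable_on_prod:
  fixes f :: "'a \<Rightarrow> complex" and g :: "'b \<Rightarrow> complex"
  assumes "f abs_summable_on UNIV" "g abs_summable_on UNIV"
  shows "(\<lambda>(x, y). f x * g y) abs_summable_on UNIV"
proof -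
  have "(\<lambda>(x, y). f x * g y) abs_summable_on UNIV \<times> UNIV"
    by (rule iffD2[OF Infinite_Sum.abs_summable_on_Sigma_iff])
       (use assms in \<open>auto simp: norm_mult abs_mult infsum_nonneg infsum_cmult_right' intro!: summable_on_cmult_right summable_on_cmult_left\<close>)
  thus ?thesis by simp
qed

lemma has_sum_prod:
  fixes f :: "'a \<Rightarrow> complex" and g :: "'b \<Rightarrow> complex"
  assumes "f abs_summable_on UNIV" "g abs_summable_on UNIV"
    and "(f has_sum a) UNIV" "(g has_sum b) UNIV"
  shows "((\<lambda>(x, y). f x * g y) has_sum (a * b)) UNIV"
proof -
  have "((\<lambda>(x, y). f x * g y) has_sum (a * b)) (UNIV \<times> UNIV)"
    by (rule has_sum_SigmaI[where g = "\<lambda>x. f x * b"])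
       (use abs_summable_summable[OF abs_summable_on_prod[OF assms(1,2)]] assms(3,4)
        in \<open>auto intro: has_sum_cmult_right has_sum_cmult_left\<close>)
  thus ?thesis by simp
qed

lemma seq_away_from_0_inverse_bounded:
  fixes f :: "nat \<Rightarrow> complex"
  assumes "f \<longlonglongrightarrow> L" "L \<noteq> 0" "\<And>n. f n \<noteq> 0"
  obtains M where "M > 0" "\<And>n. norm (inverse (f n)) \<le> M"
proof -
  have "(\<lambda>n. inverse (f n)) \<longlonglongrightarrow> inverse L"
    using assms by (intro tendsto_inverse) auto
  hence "Bseq (\<lambda>n. inverse (f n))"
    by (intro convergent_imp_Bseq) (auto simp: convergent_def)
  thus ?thesis using that unfolding Bseq_def by auto
qed

text \<open>
  The variant for iterated sums neither of which is known in advance.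
\<close>

lemma has_sum_fubini_ex:
  fixes f :: "'a \<times> 'b \<Rightarrow> complex"
  assumes "f abs_summable_on UNIV"
    and "\<And>x. ((\<lambda>y. f (x, y)) has_sum g x) UNIV"
    and "\<And>y. ((\<lambda>x. f (x, y)) has_sum h y) UNIV"
  shows "\<exists>S. (g has_sum S) UNIV \<and> (h has_sum S) UNIV"
proof -
  obtain S where "(f has_sum S) (UNIV \<times> UNIV)"
    using abs_summable_summable[OF assms(1)] by (auto simp: summable_on_def)
  hence 1: "(g has_sum S) UNIV" using has_sum_SigmaD[OF _ assms(2)] by blast
  have "(\<lambda>(y, x). f (x, y)) abs_summable_on UNIV"
    using assms(1) summable_on_reindex_bij_betw[of prod.swap UNIV UNIV "\<lambda>x. norm (f x)"] 
    by (simp add: case_prod_unfold prod.swap_def bij_swap)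
  from has_sum_fubini[OF this, of h g S] 1 assms have "(h has_sum S) UNIV" by simp
  with 1 show ?thesis by blast
qed

lemma has_sum_bij:
  assumes "(f has_sum S) UNIV" "bij g"
  shows "((\<lambda>x. f (g x)) has_sum S) UNIV"
  by (rule iffD2[OF has_sum_reindex_bij_betw[OF assms(2)] assms(1)])

lemma sums_cmult_eq:
  fixes f :: "nat \<Rightarrow> complex"
  assumes "(\<lambda>n. c * f n) sums s" "c \<noteq> 0"
  shows "s = c * suminf f"
  using sums_mult[OF assms(1), of "1 / c"] assms(2) by (simp add: sums_iff)

section \<open>A majorant with Gaussian decay\<close>

text \<open>
  Gaussian weights \<open>r\<^bsup>n(n-1)/2\<^esup>\<close> for \<open>0 < r < 1\<close>: this is the size of the Euler coefficients, of
  the theta coefficients and of the coefficients of \<open>\<psi>\<close>.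
\<close>

definition gauss_power :: "real \<Rightarrow> nat \<Rightarrow> real"
  where "gauss_power r n = r ^ (n choose 2)"

lemma choose2_Suc: "Suc n choose 2 = n + (n choose 2)"
  by (simp add: numeral_2_eq_2)

lemma gauss_power_0 [simp]: "gauss_power r 0 = 1"
  by (simp add: gauss_power_def numeral_2_eq_2)

lemma gauss_power_Suc: "gauss_power r (Suc n) = r ^ n * gauss_power r n"
  by (simp add: gauss_power_def choose2_Suc power_add)

lemma gauss_power_pos: "r > 0 \<Longrightarrow> gauss_power r n > 0"
  by (simp add: gauss_power_def)

lemma summable_gauss_power:
  assumes r: "0 < r" "r < 1" and t: "t \<ge> 0"
  shows "summable (\<lambda>n. gauss_power r n * t ^ n)"
proof -
  have "(\<lambda>n. r ^ n * t) \<longlonglongrightarrow> 0 * t"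
    by (intro tendsto_intros LIMSEQ_power_zero) (use r in auto)
  hence "eventually (\<lambda>n. r ^ n * t < 1 / 2) sequentially"
    by (rule order_tendstoD) auto
  then obtain N where N: "\<And>n. n \<ge> N \<Longrightarrow> r ^ n * t < 1 / 2"
    by (auto simp: eventually_sequentially)
  show ?thesis
  proof (rule summable_ratio_test[of "1/2" N])
    fix n assume n: "n \<ge> N"
    have "norm (gauss_power r (Suc n) * t ^ Suc n) = r ^ n * t * (gauss_power r n * t ^ n)"
      using r t gauss_power_pos[OF r(1), of n] by (simp add: gauss_power_Suc abs_mult mult_ac)
    also have "\<dots> \<le> 1 / 2 * (gauss_power r n * t ^ n)"
      using N[OF n] r t gauss_power_pos[OF r(1), of n] by (intro mult_right_mono) auto
    finally show "norm (gauss_power r (Suc n) * t ^ Suc n) \<le> 1 / 2 * norm (gauss_power r n * t ^ n)"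
      using r t gauss_power_pos[OF r(1), of n] by (simp add: abs_mult)
  qed auto
qed

definition partial_theta :: "real \<Rightarrow> real \<Rightarrow> real"
  where "partial_theta r t = (\<Sum>n. gauss_power r n * t ^ n)"

lemma has_sum_partial_theta:
  assumes r: "0 < r" "r < 1" and t: "t \<ge> 0"
  shows "((\<lambda>n. gauss_power r n * t ^ n) has_sum partial_theta r t) UNIV"
  unfolding partial_theta_def
  by (rule sums_nonneg_imp_has_sum[OF summable_sums[OF summable_gauss_power]])
     (use assms gauss_power_pos[OF r(1)] in \<open>auto simp: less_imp_le\<close>)

text \<open>
  Each step from \<open>t\<close> to \<open>t / r\<close> multiplies the partial theta function by about \<open>t / r\<close>.  This is
  the growth that has to be weighed against \<open>gauss_power r i\<close> in the next lemmas.
\<close>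

lemma partial_theta_step:
  assumes r: "0 < r" "r < 1" and t: "t \<ge> 0"
  shows "partial_theta r (t / r) = 1 + t / r * partial_theta r t"
proof -
  have s: "summable (\<lambda>n. gauss_power r n * (t / r) ^ n)"
    using summable_gauss_power[OF r, of "t / r"] r t by auto
  have "gauss_power r (Suc n) * (t / r) ^ Suc n = t / r * (gauss_power r n * t ^ n)" for n
    using r by (simp add: gauss_power_Suc power_divide field_simps)
  hence "(\<Sum>n. gauss_power r (Suc n) * (t / r) ^ Suc n) = t / r * (\<Sum>n. gauss_power r n * t ^ n)"
    by (simp only: suminf_mult[OF summable_gauss_power[OF r t]])
  thus ?thesis
    unfolding partial_theta_def using suminf_split_head[OF s] by simp
qed

lemma partial_theta_ge_1:
  assumes r: "0 < r" "r < 1" and t: "t \<ge> 0"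
  shows "partial_theta r t \<ge> 1"
proof -
  have "(\<Sum>n\<in>{0}. gauss_power r n * t ^ n) \<le> (\<Sum>n. gauss_power r n * t ^ n)"
    by (rule sum_le_suminf[OF summable_gauss_power[OF r t]])
       (use t gauss_power_pos[OF r(1)] in \<open>auto simp: less_imp_le\<close>)
  thus ?thesis by (simp add: partial_theta_def)
qed

text \<open>
  By \<open>partial_theta_step\<close> the ratio of consecutive terms is at most \<open>r\<^sup>i X + X t / r\<close>: the factor
  \<open>r\<^sup>i\<close> from the Gaussian weight cancels the factor \<open>t / r\<^bsup>i+1\<^esup>\<close> of the partial theta function.
  So the condition \<open>X t < r\<close> is what makes the ratio test succeed.
\<close>

lemma summable_gauss_partial_theta:
  assumes r: "0 < r" "r < 1" and t: "t \<ge> 0" and X: "X \<ge> 0" and Xt: "X * t < r"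
  shows "summable (\<lambda>i. gauss_power r i * X ^ i * partial_theta r (t / r ^ i))"
proof -
  have "(\<lambda>n. r ^ n * X + X * t / r) \<longlonglongrightarrow> 0 * X + X * t / r"
    by (intro tendsto_intros LIMSEQ_power_zero) (use r in auto)
  moreover obtain \<rho> where \<rho>: "X * t / r < \<rho>" "\<rho> < 1"
    using dense[of "X * t / r" 1] Xt r by auto
  ultimately have "eventually (\<lambda>n. r ^ n * X + X * t / r < \<rho>) sequentially"
    using order_tendstoD(2) by fastforce
  then obtain N where N: "\<And>n. n \<ge> N \<Longrightarrow> r ^ n * X + X * t / r < \<rho>"
    by (auto simp: eventually_sequentially)
  define f where "f = (\<lambda>i. gauss_power r i * X ^ i * partial_theta r (t / r ^ i))"
  have nonneg: "f i \<ge> 0" for i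
    unfolding f_def using gauss_power_pos[OF r(1), of i] X partial_theta_ge_1[OF r, of "t / r ^ i"] r t
    by (intro mult_nonneg_nonneg) auto
  have "summable f"
  proof (rule summable_ratio_test[of \<rho> N])
    fix n assume n: "n \<ge> N"
    define M where "M = partial_theta r (t / r ^ n)"
    have M1: "M \<ge> 1"
      unfolding M_def using r t by (intro partial_theta_ge_1) auto
    have M: "partial_theta r (t / r ^ Suc n) = 1 + t / r ^ Suc n * M"
      using partial_theta_step[OF r, of "t / r ^ n"] r t by (simp add: M_def mult.commute)
    define A where "A = gauss_power r n * X ^ n"
    have A: "A \<ge> 0" unfolding A_def using gauss_power_pos[OF r(1), of n] X by simp
    have "f (Suc n) = A * (r ^ n * X) * (1 + t / r ^ Suc n * M)"
      unfolding f_def M A_def by (simp add: gauss_power_Suc mult_ac)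
    also have "\<dots> \<le> A * (r ^ n * X) * (M + t / r ^ Suc n * M)"
      using M1 A r X by (intro mult_left_mono add_right_mono mult_nonneg_nonneg) auto
    also have "\<dots> = (r ^ n * X + X * t / r) * (A * M)"
      using r by (simp add: field_simps)
    also have "\<dots> \<le> \<rho> * (A * M)"
      using N[OF n] A M1 by (intro mult_right_mono) auto
    also have "A * M = f n"
      by (simp add: f_def A_def M_def)
    finally show "norm (f (Suc n)) \<le> \<rho> * norm (f n)"
      using nonneg by simp
  qed (use \<rho> in auto)
  thus ?thesis by (simp add: f_def)
qed

text \<open>
  The common majorant of all multiple series below.  The index \<open>i\<close> belongs to a series with
  Gaussian coefficients; \<open>m\<close> and \<open>n\<close> come from Euler expansions of two infinite products, the
  first of which has the argument \<open>t / r\<^sup>i\<close> and grows with \<open>i\<close>.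
\<close>

lemma summable_on_gauss_triple:
  assumes r: "0 < r" "r < 1" and t: "t \<ge> 0" and X: "X \<ge> 0" and s: "s \<ge> 0" and Xt: "X * t < r"
  shows "(\<lambda>(i, m, n). gauss_power r i * X ^ i * (gauss_power r m * (t / r ^ i) ^ m)
            * (gauss_power r n * s ^ n)) summable_on UNIV"
    (is "?f summable_on UNIV")
proof -
  have nn: "gauss_power r k \<ge> 0" for k using gauss_power_pos[OF r(1), of k] by simp
  have inner: "((\<lambda>y. ?f (i, y)) has_sum
      (gauss_power r i * X ^ i * partial_theta r (t / r ^ i)) * partial_theta r s) UNIV" (is "(?g i has_sum ?S i) UNIV") for i
  proof -
    define A where "A = gauss_power r i * X ^ i"
    have A0: "A \<ge> 0" using nn X by (simp add: A_def)
    have h1: "((\<lambda>n. gauss_power r n * (t / r ^ i) ^ n) has_sum partial_theta r (t / r ^ i)) UNIV"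
      using r t by (intro has_sum_partial_theta) auto
    have h2: "((\<lambda>n. gauss_power r n * s ^ n) has_sum partial_theta r s) UNIV"
      using r s by (intro has_sum_partial_theta) auto
    have a: "((\<lambda>n. ?g i (m, n)) has_sum (A * (gauss_power r m * (t / r ^ i) ^ m) * partial_theta r s)) UNIV" for m
      unfolding A_def case_prod_conv by (intro has_sum_cmult_right h2)
    have b: "((\<lambda>m. A * (gauss_power r m * (t / r ^ i) ^ m) * partial_theta r s) has_sum ?S i) UNIV"
      unfolding A_def[symmetric] by (intro has_sum_cmult_right has_sum_cmult_left h1)
    have c: "?g i summable_on UNIV \<times> UNIV"
      by (rule summable_on_SigmaI[OF a])
         (use b r t s A0 nn in \<open>auto simp: has_sum_imp_summable A_def\<close>)
    show ?thesis using has_sum_SigmaI[OF a b c] by simp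
  qed
  have "?S summable_on UNIV"
  proof (rule summable_nonneg_imp_summable_on)
    show "summable ?S"
      using summable_mult2[OF summable_gauss_partial_theta[OF r t X Xt], of "partial_theta r s"] by simp
    show "?S i \<ge> 0" for i
      using nn X partial_theta_ge_1[OF r, of "t / r ^ i"] partial_theta_ge_1[OF r s] r t
      by (intro mult_nonneg_nonneg) auto
  qed
  from summable_on_SigmaI[where B = "\<lambda>_. UNIV", OF inner this]
  have "?f summable_on UNIV \<times> UNIV"
    using nn X r t s by auto
  thus ?thesis by simp
qed

lemma summable_on_gauss_pair:
  assumes r: "0 < r" "r < 1" and t: "t \<ge> 0" and X: "X \<ge> 0" and Xt: "X * t < r"
  shows "(\<lambda>(i, m). gauss_power r i * X ^ i * (gauss_power r m * (t / r ^ i) ^ m)) summable_on UNIV"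
proof -
  have "inj (\<lambda>(i, m). (i, m, 0 :: nat))" by (auto simp: inj_on_def)
  moreover have "(\<lambda>(i, m, n). gauss_power r i * X ^ i * (gauss_power r m * (t / r ^ i) ^ m)
            * (gauss_power r n * 1 ^ n)) summable_on range (\<lambda>(i, m). (i, m, 0))"
    by (rule summable_on_subset_banach[OF summable_on_gauss_triple[OF r t X _ Xt]]) auto
  ultimately show ?thesis
    by (subst (asm) summable_on_reindex) (auto simp: o_def case_prod_unfold)
qed

section \<open>Infinite products and the q-binomial theorem\<close>

locale nome =
  fixes q :: complex
  assumes q_nz: "q \<noteq> 0" and q_lt_1: "norm q < 1"
begin

abbreviation Q :: "complex \<Rightarrow> complex" where "Q x \<equiv> qpoch_inf x q"

definition poch :: "complex \<Rightarrow> nat \<Rightarrow> complex"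
  where "poch x n = (\<Prod>k<n. 1 - x * q ^ k)"

abbreviation r :: real where "r \<equiv> norm q"

lemma r_bounds [simp]: "0 < r" "r < 1" "r \<le> 1" "q \<noteq> 0"
  using q_nz q_lt_1 by auto

lemma q_pow_tendsto_0: "(\<lambda>n. q ^ n) \<longlonglongrightarrow> 0"
  by (rule LIMSEQ_power_zero) (use q_lt_1 in auto)

lemma poch_0 [simp]: "poch x 0 = 1"
  by (simp add: poch_def)

lemma poch_Suc: "poch x (Suc n) = poch x n * (1 - x * q ^ n)"
  by (simp add: poch_def)

lemma poch_Suc_left: "poch x (Suc n) = (1 - x) * poch (x * q) n"
  by (simp add: poch_def prod.lessThan_Suc_shift mult_ac del: prod.lessThan_Suc)

lemma qpoch_nat: "qpoch x q (int n) = poch x n"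
  by (simp add: qpoch_def poch_def)

lemma Q_split: "Q x = Q (x * q ^ n) * poch x n"
  unfolding poch_def by (rule qpoch_inf_split[OF q_lt_1])

lemma Q_step: "Q x = (1 - x) * Q (x * q)"
  using Q_split[of x 1] by (simp add: poch_def)

lemma Q_0 [simp]: "Q 0 = 1"
  by (simp add: qpoch_inf_def)

lemma Q_eq_0_iff: "Q x = 0 \<longleftrightarrow> (\<exists>k. x * q ^ k = 1)"
  unfolding qpoch_inf_def
  using has_prod_eq_0_iff[OF convergent_prod_has_prod[OF convergent_prod_qpoch[OF q_lt_1, of x]]]
  by (simp add: image_iff)

lemma Q_nonzero_shift: "Q x \<noteq> 0 \<Longrightarrow> Q (x * q ^ n) \<noteq> 0"
  using Q_split[of x n] by auto

lemma poch_nonzero: "Q x \<noteq> 0 \<Longrightarrow> poch x n \<noteq> 0"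
  using Q_split[of x n] by auto

lemma Q_nonzero_small: "norm x < 1 \<Longrightarrow> Q x \<noteq> 0"
proof
  assume x: "norm x < 1" and "Q x = 0"
  then obtain k where k: "x * q ^ k = 1" using Q_eq_0_iff by blast
  have "norm (x * q ^ k) \<le> norm x * 1"
    unfolding norm_mult norm_power by (intro mult_left_mono power_le_one) (use q_lt_1 in auto)
  thus False using k x by simp
qed

lemma Q_q_nonzero [simp]: "Q q \<noteq> 0"
  by (rule Q_nonzero_small) simp

lemma poch_tendsto: "poch x \<longlonglongrightarrow> Q x"
  unfolding poch_def qpoch_inf_def
  by (rule has_prod_imp_tendsto'[OF convergent_prod_has_prod[OF convergent_prod_qpoch[OF q_lt_1]]])

lemma poch_inverse_bounded:
  assumes "Q x \<noteq> 0"
  obtains M where "M > 0" "\<And>n. norm (inverse (poch x n)) \<le> M"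
  using seq_away_from_0_inverse_bounded[OF poch_tendsto[of x] assms] poch_nonzero[OF assms] by metis

lemma poch_bounded:
  obtains M where "M > 0" "\<And>n. norm (poch x n) \<le> M"
proof -
  have "Bseq (poch x)"
    by (intro convergent_imp_Bseq) (use poch_tendsto in \<open>auto simp: convergent_def\<close>)
  thus ?thesis using that unfolding Bseq_def by auto
qed

lemma one_minus_shift_nonzero: "Q x \<noteq> 0 \<Longrightarrow> 1 - x * q ^ n \<noteq> 0"
  using Q_eq_0_iff by (metis eq_iff_diff_eq_0)

lemma one_minus_inverse_bounded:
  assumes "Q x \<noteq> 0"
  obtains M where "M > 0" "\<And>n. norm (inverse (1 - x * q ^ n)) \<le> M"
proof -
  have "(\<lambda>n. 1 - x * q ^ n) \<longlonglongrightarrow> 1 - x * 0"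
    by (intro tendsto_intros q_pow_tendsto_0)
  from seq_away_from_0_inverse_bounded[OF this] one_minus_shift_nonzero[OF assms]
  show ?thesis using that by auto
qed

lemma qbinomial_summable:
  assumes t: "norm t < 1"
  shows "summable (\<lambda>n. norm ((\<Prod>j<n. t - w * q ^ j) / poch q n))"
proof -
  define c where "c = (\<lambda>n. (\<Prod>j<n. t - w * q ^ j) / poch q n)"
  have "(\<lambda>n. norm ((t - w * q ^ n) / (1 - q * q ^ n))) \<longlonglongrightarrow> norm ((t - w * 0) / (1 - q * 0))"
    by (intro tendsto_intros q_pow_tendsto_0) auto
  moreover obtain \<rho> where \<rho>: "norm t < \<rho>" "\<rho> < 1" using dense[OF t] by auto
  ultimately have "eventually (\<lambda>n. norm ((t - w * q ^ n) / (1 - q * q ^ n)) < \<rho>) sequentially"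
    using order_tendstoD(2) by fastforce
  then obtain N where N: "\<And>n. n \<ge> N \<Longrightarrow> norm ((t - w * q ^ n) / (1 - q * q ^ n)) < \<rho>"
    by (auto simp: eventually_sequentially)
  have "summable (\<lambda>n. norm (c n))"
  proof (rule summable_ratio_test[of \<rho> N])
    fix n assume n: "n \<ge> N"
    have "c (Suc n) = (t - w * q ^ n) / (1 - q * q ^ n) * c n"
      by (simp add: c_def poch_Suc mult_ac)
    hence "norm (c (Suc n)) = norm ((t - w * q ^ n) / (1 - q * q ^ n)) * norm (c n)"
      by (simp only: norm_mult)
    also have "\<dots> \<le> \<rho> * norm (c n)"
      using N[OF n] by (intro mult_right_mono) auto
    finally show "norm (norm (c (Suc n))) \<le> \<rho> * norm (norm (c n))" by simp
  qed (use \<rho> in auto)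
  thus ?thesis by (simp add: c_def)
qed

text \<open>
  The q-binomial theorem in homogeneous form, which contains both Euler series (\<open>t = 0\<close> and
  \<open>w = 0\<close>).  If \<open>f\<close> is the series with \<open>(t, w)\<close> scaled by \<open>z\<close>, comparing coefficients gives
  \<open>(1 - t z) f z = (1 - w z) f (z q)\<close>; iterate at \<open>z = 1\<close> and use that \<open>f\<close> is continuous at \<open>0\<close>.
\<close>

lemma qbinomial_sums:
  assumes t: "norm t < 1"
  shows "(\<lambda>n. (\<Prod>j<n. t - w * q ^ j) / poch q n) sums (Q w / Q t)"
proof -
  define P where "P = (\<lambda>n. (\<Prod>j<n. t - w * q ^ j) / poch q n)"
  define f where "f = (\<lambda>z. \<Sum>n. P n * z ^ n)"
  have sumP: "summable (\<lambda>n. norm (P n))"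
    using qbinomial_summable[OF t, of w] by (simp add: P_def)
  have summ: "summable (\<lambda>n. P n * z ^ n)" if "norm z \<le> 1" for z
  proof (rule summable_comparison_test'[OF sumP, of 0])
    fix n show "norm (P n * z ^ n) \<le> norm (P n)"
      using that by (simp add: norm_mult norm_power mult_left_le power_le_one)
  qed
  have step: "(1 - t * z) * f z = (1 - w * z) * f (z * q)" if z: "norm z \<le> 1" for z
  proof -
    have zq: "norm (z * q) \<le> 1"
      using mult_le_one[OF z, of r] by (simp add: norm_mult)
    have s1: "(\<lambda>n. P n * z ^ n) sums f z" and s2: "(\<lambda>n. P n * (z * q) ^ n) sums f (z * q)"
      unfolding f_def by (intro summable_sums summ z zq)+
    have s3: "(\<lambda>n. P n * z ^ n - P n * (z * q) ^ n) sums (f z - f (z * q))"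
      by (rule sums_diff[OF s1 s2])
    hence "(\<lambda>n. P (Suc n) * z ^ Suc n - P (Suc n) * (z * q) ^ Suc n) sums (f z - f (z * q))"
      by (subst sums_Suc_iff) simp
    moreover have "P (Suc n) * z ^ Suc n - P (Suc n) * (z * q) ^ Suc n
        = z * t * (P n * z ^ n) - z * w * (P n * (z * q) ^ n)" for n
    proof -
      have nz: "1 - q * q ^ n \<noteq> 0" by (rule one_minus_shift_nonzero) simp
      have "P (Suc n) * (1 - q * q ^ n) = P n * (t - w * q ^ n)"
        using nz by (simp add: P_def poch_Suc)
      hence "P (Suc n) * (1 - q * q ^ n) * z ^ Suc n = P n * (t - w * q ^ n) * z ^ Suc n"
        by simp
      thus ?thesis by (simp add: algebra_simps power_mult_distrib)
    qed
    ultimately have "(\<lambda>n. z * t * (P n * z ^ n) - z * w * (P n * (z * q) ^ n)) sums (f z - f (z * q))"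
      by simp
    moreover have "(\<lambda>n. z * t * (P n * z ^ n) - z * w * (P n * (z * q) ^ n)) sums (z * t * f z - z * w * f (z * q))"
      by (intro sums_diff sums_mult s1 s2)
    ultimately have "f z - f (z * q) = z * t * f z - z * w * f (z * q)"
      using sums_unique2 by blast
    thus ?thesis by (simp add: algebra_simps)
  qed
  have iter: "poch t N * f 1 = poch w N * f (q ^ N)" for N
  proof (induction N)
    case (Suc N)
    have "norm (q ^ N) \<le> 1" using q_lt_1 by (simp add: norm_power power_le_one)
    from step[OF this] have "(1 - t * q ^ N) * f (q ^ N) = (1 - w * q ^ N) * f (q ^ Suc N)"
      by (simp add: mult.commute)
    note st = this
    have "poch t (Suc N) * f 1 = (1 - t * q ^ N) * (poch t N * f 1)" by (simp add: poch_Suc)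
    also have "\<dots> = poch w N * ((1 - t * q ^ N) * f (q ^ N))" unfolding Suc by simp
    also have "\<dots> = poch w (Suc N) * f (q ^ Suc N)" unfolding st by (simp add: poch_Suc)
    finally show ?case .
  qed auto
  have "isCont f 0"
    unfolding f_def by (rule isCont_powser[of _ 1]) (use summ[of 1] in auto)
  hence "(\<lambda>N. f (q ^ N)) \<longlonglongrightarrow> f 0"
    by (rule isCont_tendsto_compose[OF _ q_pow_tendsto_0])
  moreover have "f 0 = 1"
    unfolding f_def powser_zero by (simp add: P_def)
  ultimately have "(\<lambda>N. poch w N * f (q ^ N)) \<longlonglongrightarrow> Q w * 1"
    by (intro tendsto_mult poch_tendsto) simp
  moreover have "(\<lambda>N. poch w N * f (q ^ N)) \<longlonglongrightarrow> Q t * f 1"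
    unfolding iter[symmetric] by (intro tendsto_intros poch_tendsto)
  ultimately have "Q t * f 1 = Q w" using LIMSEQ_unique by fastforce
  hence "f 1 = Q w / Q t" using Q_nonzero_small[OF t] by (simp add: field_simps)
  thus ?thesis using summable_sums[OF summ[of 1]] by (simp add: f_def P_def)
qed

lemma qbinomial:
  assumes t: "norm t < 1"
  shows "((\<lambda>n. (\<Prod>j<n. t - w * q ^ j) / poch q n) has_sum (Q w / Q t)) UNIV"
  by (rule norm_summable_imp_has_sum[OF qbinomial_summable[OF t] qbinomial_sums[OF t]])

text \<open>
  The coefficients of Euler's expansion of \<open>Q w\<close> in powers of \<open>w\<close>.
\<close>

definition eps :: "nat \<Rightarrow> complex"
  where "eps n = (- 1) ^ n * q ^ (n choose 2) / poch q n"

lemma eps_0 [simp]: "eps 0 = 1"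
  by (simp add: eps_def numeral_2_eq_2)

lemma eps_Suc: "eps (Suc n) * (1 - q ^ Suc n) = - (q ^ n) * eps n"
  using one_minus_shift_nonzero[OF Q_q_nonzero, of n]
  by (simp add: eps_def choose2_Suc power_add poch_Suc)

lemma euler_coeff: "(\<Prod>j<n. 0 - w * q ^ j) / poch q n = eps n * w ^ n"
proof -
  have "(\<Prod>j<n. 0 - w * q ^ j) = (- 1) ^ n * q ^ (n choose 2) * w ^ n"
    by (induction n) (auto simp: numeral_2_eq_2 power_add)
  thus ?thesis by (simp add: eps_def)
qed

lemma euler: "((\<lambda>n. eps n * w ^ n) has_sum Q w) UNIV"
  using qbinomial[of 0 w] by (simp only: euler_coeff) simp

lemma eps_bound: 
  obtains M where "M > 0" "\<And>n. norm (eps n) \<le> M * gauss_power r n"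
proof -
  obtain M where M: "M > 0" "\<And>n. norm (inverse (poch q n)) \<le> M"
    using poch_inverse_bounded[OF Q_q_nonzero] by blast
  have "norm (eps n) \<le> M * gauss_power r n" for n
  proof -
    have "norm (eps n) = norm (inverse (poch q n)) * gauss_power r n"
      by (simp add: eps_def gauss_power_def norm_mult norm_power norm_divide divide_inverse norm_inverse)
    also have "\<dots> \<le> M * gauss_power r n"
      using M(2)[of n] gauss_power_pos[of r n] by (intro mult_right_mono) (auto simp: less_imp_le q_nz)
    finally show ?thesis .
  qed
  with M(1) show ?thesis using that by blast
qed

lemma euler_abs_summable: "(\<lambda>n. eps n * w ^ n) abs_summable_on UNIV"
  by (rule summable_nonneg_imp_summable_on)
     (use qbinomial_summable[of 0 w] in \<open>simp_all only: euler_coeff norm_zero norm_ge_zero zero_less_one\<close>)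

section \<open>Shifted factorials with negative index\<close>

lemma powi_neg: "x powi (- int n) = 1 / (x :: complex) ^ n"
  by (simp only: power_int_minus power_int_of_nat inverse_eq_divide)

lemma shifted_prod:
  assumes "x \<noteq> 0"
  shows "(\<Prod>k<i. 1 - x * q powi (- int i) * q ^ k) = (- x / q) ^ i / q ^ (i choose 2) * poch (q / x) i"
proof (induction i)
  case (Suc i)
  have e: "q powi (- int (Suc i)) * q ^ Suc k = q powi (- int i) * q ^ k" for k
    unfolding powi_neg using q_nz by simp
  have "(\<Prod>k<Suc i. 1 - x * q powi (- int (Suc i)) * q ^ k)
      = (1 - x * q powi (- int (Suc i))) * (\<Prod>k<i. 1 - x * (q powi (- int (Suc i)) * q ^ Suc k))"
    by (simp add: prod.lessThan_Suc_shift mult.assoc del: prod.lessThan_Suc power_Suc)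
  also have "(\<Prod>k<i. 1 - x * (q powi (- int (Suc i)) * q ^ Suc k))
      = (\<Prod>k<i. 1 - x * q powi (- int i) * q ^ k)"
    unfolding e by (simp add: mult.assoc)
  also have "(1 - x * q powi (- int (Suc i))) = (- x / q) / q ^ i * (1 - q / x * q ^ i)"
    unfolding powi_neg using q_nz assms by (simp add: field_simps)
  also have "\<dots> * (\<Prod>k<i. 1 - x * q powi (- int i) * q ^ k)
      = (- x / q) ^ Suc i / q ^ (Suc i choose 2) * poch (q / x) (Suc i)"
    unfolding Suc by (simp add: poch_Suc choose2_Suc power_add mult_ac)
  finally show ?case .
qed (simp add: numeral_2_eq_2)

lemma Q_shift_neg:
  assumes "x \<noteq> 0"
  shows "Q (x * q powi (- int i)) = Q x * ((- x / q) ^ i / q ^ (i choose 2) * poch (q / x) i)"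
proof -
  have "x * q powi (- int i) * q ^ i = x"
    using q_nz by (simp add: power_int_minus)
  thus ?thesis
    using qpoch_inf_split[OF q_lt_1, of "x * q powi (- int i)" i] shifted_prod[OF assms, of i] by metis
qed

lemma qpoch_neg:
  assumes "x \<noteq> 0"
  shows "qpoch x q (- int i) = (- q / x) ^ i * q ^ (i choose 2) / poch (q / x) i"
proof (cases "i = 0")
  case True thus ?thesis by (simp add: qpoch_def numeral_2_eq_2)
next
  case False
  hence "qpoch x q (- int i) = 1 / (\<Prod>k<i. 1 - x * q powi (- int i) * q ^ k)"
    by (simp add: qpoch_def)
  also have "\<dots> = (- q / x) ^ i * q ^ (i choose 2) / poch (q / x) i"
    unfolding shifted_prod[OF assms] using assms q_nz
    by (cases "even i") (simp_all add: power_divide field_simps)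
  finally show ?thesis .
qed

lemma qpoch_succ:
  assumes "x \<noteq> 0" "x * q powi k \<noteq> 1"
  shows "qpoch x q (k + 1) = qpoch x q k * (1 - x * q powi k)"
proof (cases "k \<ge> 0")
  case True
  then obtain n where k: "k = int n" by (metis nonneg_int_cases)
  have "k + 1 = int (Suc n)" by (simp add: k)
  thus ?thesis unfolding k by (simp only: qpoch_nat poch_Suc power_int_of_nat)
next
  case False
  define n where "n = nat (- k - 1)"
  have k: "k = - int (Suc n)" "k + 1 = - int n" using False by (auto simp: n_def)
  have kq: "q powi k = 1 / q ^ Suc n"
    unfolding k(1) by (simp only: power_int_minus power_int_of_nat inverse_eq_divide)
  have nz: "1 - q / x * q ^ n \<noteq> 0"
    using assms q_nz unfolding kq by (auto simp: field_simps)
  have "(- q / x) * q ^ n * (1 - x * q powi k) = 1 - q / x * q ^ n"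
    using assms q_nz unfolding kq by (simp add: field_simps)
  hence "(- q / x) * q ^ n * (1 - x * q powi k) / (1 - q / x * q ^ n) = 1"
    using nz by simp
  hence "(- q / x) ^ n * q ^ (n choose 2) / poch (q / x) n
     = (- q / x) ^ n * q ^ (n choose 2) / poch (q / x) n * ((- q / x) * q ^ n * (1 - x * q powi k) / (1 - q / x * q ^ n))"
    by (simp only: mult_1_right)
  also have "\<dots> = (- q / x) ^ Suc n * q ^ (Suc n choose 2) / poch (q / x) (Suc n) * (1 - x * q powi k)"
    by (simp add: poch_Suc choose2_Suc power_add mult_ac)
  finally show ?thesis unfolding k(2) unfolding k(1) qpoch_neg[OF assms(1)] .
qed

text \<open>
  What remains of the \<open>\<^sub>2\<psi>\<^sub>2\<close> coefficient after the factors depending on \<open>a\<close> and \<open>c\<close> are split off, with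
  \<open>p = q / d\<close>.  Keeping \<open>(b;q)\<^sub>k\<close> instead of \<open>1 / Q (b q\<^sup>k)\<close> includes the case where \<open>b\<close> is \<open>q\<^bsup>-m\<^esup>\<close>.
\<close>

definition psi_coeff :: "complex \<Rightarrow> complex \<Rightarrow> int \<Rightarrow> complex"
  where "psi_coeff b p k = qpoch b q k / Q (p * q powi (- k))"

lemma psi_coeff_bound_pos:
  assumes "p \<noteq> 0" "Q p \<noteq> 0" "Q (q / p) \<noteq> 0"
  obtains M where "M > 0" "\<And>i. norm (psi_coeff b p (int i)) \<le> M * (gauss_power r i * (r / norm p) ^ i)"
proof -
  obtain M1 where M1: "M1 > 0" "\<And>n. norm (poch b n) \<le> M1" using poch_bounded by blast
  obtain M2 where M2: "M2 > 0" "\<And>n. norm (inverse (poch (q / p) n)) \<le> M2"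
    using poch_inverse_bounded[OF assms(3)] by blast
  have "norm (psi_coeff b p (int i)) \<le> M1 * M2 / norm (Q p) * (gauss_power r i * (r / norm p) ^ i)" for i
  proof -
    have "norm (psi_coeff b p (int i)) = norm (poch b i) * norm (inverse (poch (q / p) i)) / norm (Q p) * (gauss_power r i * (r / norm p) ^ i)"
      unfolding psi_coeff_def Q_shift_neg[OF assms(1)] qpoch_nat
      using assms q_nz by (simp add: norm_mult norm_divide norm_power norm_inverse gauss_power_def power_divide field_simps)
    also have "\<dots> \<le> M1 * M2 / norm (Q p) * (gauss_power r i * (r / norm p) ^ i)"
      using M1 M2 gauss_power_pos[of r i] by (intro mult_right_mono divide_right_mono mult_mono) (auto simp: less_imp_le q_nz)
    finally show ?thesis .
  qed
  thus ?thesis using that[of "M1 * M2 / norm (Q p)"] M1(1) M2(1) assms(2) by simp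
qed

lemma psi_coeff_bound_neg:
  assumes "b \<noteq> 0" "Q p \<noteq> 0" "Q (q / b) \<noteq> 0"
  obtains M where "M > 0" "\<And>i. norm (psi_coeff b p (- int i)) \<le> M * (gauss_power r i * (r / norm b) ^ i)"
proof -
  obtain M1 where M1: "M1 > 0" "\<And>n. norm (poch p n) \<le> M1" using poch_bounded by blast
  obtain M2 where M2: "M2 > 0" "\<And>n. norm (inverse (poch (q / b) n)) \<le> M2"
    using poch_inverse_bounded[OF assms(3)] by blast
  have "norm (psi_coeff b p (- int i)) \<le> M1 * M2 / norm (Q p) * (gauss_power r i * (r / norm b) ^ i)" for i
  proof -
    have "psi_coeff b p (- int i) = qpoch b q (- int i) * poch p i / Q p"
      unfolding psi_coeff_def using Q_split[of p i] poch_nonzero[OF assms(2), of i] Q_nonzero_shift[OF assms(2), of i] assms(2)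
      by (simp add: field_simps)
    hence "norm (psi_coeff b p (- int i)) = norm (poch p i) * norm (inverse (poch (q / b) i)) / norm (Q p) * (gauss_power r i * (r / norm b) ^ i)"
      unfolding qpoch_neg[OF assms(1)]
      by (simp add: norm_mult norm_divide norm_power norm_inverse gauss_power_def power_divide divide_inverse)
    also have "\<dots> \<le> M1 * M2 / norm (Q p) * (gauss_power r i * (r / norm b) ^ i)"
      using M1 M2 gauss_power_pos[of r i] by (intro mult_right_mono divide_right_mono mult_mono) (auto simp: less_imp_le q_nz)
    finally show ?thesis .
  qed
  thus ?thesis using that[of "M1 * M2 / norm (Q p)"] M1(1) M2(1) assms(2) by simp
qed

lemma summable_on_gauss:
  assumes "X \<ge> 0"
  shows "(\<lambda>n. M * (gauss_power r n * X ^ n)) summable_on UNIV"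
  by (intro summable_on_cmult_right has_sum_imp_summable[OF has_sum_partial_theta]) (use assms in auto)

lemma psi_coeff_abs_summable:
  assumes "b \<noteq> 0" "p \<noteq> 0" "Q p \<noteq> 0" "Q (q / p) \<noteq> 0" "Q (q / b) \<noteq> 0"
  shows "(\<lambda>k. psi_coeff b p k * y powi k) abs_summable_on UNIV"
proof (rule abs_summable_on_int)
  obtain M where M: "\<And>i. norm (psi_coeff b p (int i)) \<le> M * (gauss_power r i * (r / norm p) ^ i)"
    using psi_coeff_bound_pos[of p b] assms by blast
  show "(\<lambda>n. psi_coeff b p (int n) * y powi int n) abs_summable_on UNIV"
  proof (rule Infinite_Sum.abs_summable_on_comparison_test'[OF summable_on_gauss])
    show "norm (psi_coeff b p (int n) * y powi int n) \<le> M * (gauss_power r n * (r / norm p * norm y) ^ n)" for n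
      using mult_right_mono[OF M[of n], of "norm y ^ n"] by (simp add: norm_mult norm_power power_mult_distrib power_divide mult_ac)
  qed simp
  obtain M where M: "\<And>i. norm (psi_coeff b p (- int i)) \<le> M * (gauss_power r i * (r / norm b) ^ i)"
    using psi_coeff_bound_neg[of b p] assms by blast
  show "(\<lambda>n. psi_coeff b p (- int n) * y powi (- int n)) abs_summable_on UNIV"
  proof (rule Infinite_Sum.abs_summable_on_comparison_test'[OF summable_on_gauss])
    show "norm (psi_coeff b p (- int n) * y powi (- int n)) \<le> M * (gauss_power r n * (r / norm b / norm y) ^ n)" for n
      using mult_right_mono[OF M[of n], of "inverse (norm y) ^ n"]
      by (simp add: norm_mult norm_power power_int_minus norm_inverse power_mult_distrib mult_ac divide_inverse power_inverse)
  qed simp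
qed

section \<open>The theta function and the triple product identity\<close>

definition tau :: "int \<Rightarrow> complex"
  where "tau j = (- 1) powi j * q powi (j * (j - 1) div 2)"

lemma even_tri: "even (j * (j - 1))" for j :: int
  by auto

lemma tau_add: "tau (m + n) = tau m * tau n * q powi (m * n)"
proof -
  have "(m + n) * (m + n - 1) = m * (m - 1) + n * (n - 1) + 2 * (m * n)"
    by (simp add: algebra_simps)
  hence "(m + n) * (m + n - 1) div 2 = m * (m - 1) div 2 + n * (n - 1) div 2 + m * n"
    using even_tri[of m] even_tri[of n] by (auto elim!: evenE)
  thus ?thesis using q_nz by (simp add: tau_def power_int_add mult_ac)
qed

lemma tau_0 [simp]: "tau 0 = 1"
  by (simp add: tau_def)

lemma tau_nonzero [simp]: "tau n \<noteq> 0"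
  using q_nz by (simp add: tau_def)

lemma tau_1 [simp]: "tau 1 = - 1" 
  by (simp add: tau_def)

lemma tau_uminus: "tau (- j) = tau j * q powi j"
proof -
  have "(- j) * (- j - 1) = j * (j - 1) + 2 * j" by (simp add: algebra_simps)
  hence "(- j) * (- j - 1) div 2 = j * (j - 1) div 2 + j"
    using even_tri[of j] by (auto elim!: evenE)
  thus ?thesis using q_nz by (simp add: tau_def power_int_add power_int_minus_left)
qed

lemma tau_reflect: "tau (1 - j) = - tau j"
  using tau_add[of 1 "- j"] q_nz by (simp add: tau_uminus power_int_minus)

lemma tau_nat: "tau (int n) = (- 1) ^ n * q ^ (n choose 2)"
proof (induction n)
  case (Suc n)
  have "tau (int (Suc n)) = tau (int n) * tau 1 * q powi (int n * 1)"
    using tau_add[of "int n" 1] by (simp only: of_nat_Suc add.commute)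
  thus ?case using Suc by (simp add: choose2_Suc power_add)
qed (simp add: numeral_2_eq_2)

lemma norm_tau_nat: "norm (tau (int n)) = gauss_power r n"
  by (simp add: tau_nat norm_mult norm_power gauss_power_def)

lemma norm_tau_neg: "norm (tau (- int n)) = gauss_power r n * r ^ n"
  by (simp add: tau_uminus norm_mult norm_power norm_tau_nat)

lemma tau_abs_summable: "(\<lambda>j. tau j * y powi j) abs_summable_on UNIV"
proof (rule abs_summable_on_int)
  show "(\<lambda>n. tau (int n) * y powi int n) abs_summable_on UNIV"
    using summable_on_gauss[of "norm y" 1] by (simp add: norm_mult norm_tau_nat norm_power)
  show "(\<lambda>n. tau (- int n) * y powi (- int n)) abs_summable_on UNIV"
    using summable_on_gauss[of "r / norm y" 1]
    by (simp add: norm_mult norm_tau_neg norm_power power_int_minus norm_inverse power_divide power_mult_distrib power_inverse divide_inverse mult_ac)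
qed

definition theta :: "complex \<Rightarrow> complex"
  where "theta y = (\<Sum>\<^sub>\<infinity>j. tau j * y powi j)"

lemma has_sum_theta: "((\<lambda>j. tau j * y powi j) has_sum theta y) UNIV"
  unfolding theta_def by (rule has_sum_infsum[OF abs_summable_summable[OF tau_abs_summable]])

lemma bij_add_int: "bij (\<lambda>j::int. j + n)"
  by (rule bij_betwI[of _ _ _ "\<lambda>j. j - n"]) auto

lemma bij_diff_int: "bij (\<lambda>j::int. n - j)"
  by (rule bij_betwI[of _ _ _ "\<lambda>j. n - j"]) auto

lemma theta_shift:
  assumes "y \<noteq> 0"
  shows "theta y = tau n * y powi n * theta (y * q powi n)"
proof -
  have "((\<lambda>j. tau (j + n) * y powi (j + n)) has_sum theta y) UNIV"
    by (rule iffD2[OF has_sum_reindex_bij_betw[OF bij_add_int[of n], of "\<lambda>j. tau j * y powi j"] has_sum_theta])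
  moreover have "tau (j + n) * y powi (j + n) = tau n * y powi n * (tau j * (y * q powi n) powi j)" for j
    using assms q_nz by (simp add: tau_add power_int_add power_int_mult_distrib mult_ac flip: power_int_mult)
  ultimately have "((\<lambda>j. tau n * y powi n * (tau j * (y * q powi n) powi j)) has_sum theta y) UNIV"
    by simp
  moreover have "((\<lambda>j. tau n * y powi n * (tau j * (y * q powi n) powi j)) has_sum
      tau n * y powi n * theta (y * q powi n)) UNIV"
    by (intro has_sum_cmult_right has_sum_theta)
  ultimately show ?thesis by (rule has_sum_unique)
qed

text \<open>
  The substitution \<open>j \<mapsto> 1 - j\<close> changes the sign of every theta coefficient, so \<open>theta 1 = 0\<close>; the
  other zeros follow by quasi-periodicity.
\<close>

lemma theta_q_power [simp]: "theta (q powi n) = 0"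
proof -
  have "((\<lambda>j. tau (1 - j) * 1 powi (1 - j)) has_sum theta 1) UNIV"
    by (rule iffD2[OF has_sum_reindex_bij_betw[OF bij_diff_int[of 1], of "\<lambda>j. tau j * 1 powi j"] has_sum_theta])
  hence "((\<lambda>j. - (tau j * 1 powi j)) has_sum theta 1) UNIV"
    by (simp add: tau_reflect)
  moreover have "((\<lambda>j. - (tau j * 1 powi j)) has_sum - theta 1) UNIV"
    by (intro has_sum_uminusI has_sum_theta)
  ultimately have "theta 1 = - theta 1" by (rule has_sum_unique)
  hence "theta 1 + theta 1 = 0" by (rule iffD1[OF eq_neg_iff_add_eq_0])
  hence "theta 1 = 0" by simp
  thus ?thesis using theta_shift[of 1 n] by simp
qed

lemma theta_step: "y \<noteq> 0 \<Longrightarrow> theta y = - y * theta (y * q)"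
  using theta_shift[of y 1] unfolding tau_1 power_int_1_right by (metis mult_minus1)

text \<open>
  Evaluate \<open>\<Sum>\<^sub>n tau n y\<^sup>n Q (q\<^bsup>n+1\<^esup>)\<close> over all integers in two ways.  The factor \<open>Q (q\<^bsup>n+1\<^esup>)\<close> vanishes for
  negative \<open>n\<close> and is \<open>Q q / (q;q)\<^sub>n\<close> otherwise, so the sum is \<open>Q q Q y\<close> by Euler.  Expanding that
  factor first and summing over \<open>n\<close> gives theta values at \<open>y q\<^sup>m\<close>, hence \<open>theta y\<close> times the
  other Euler series, which is \<open>1 / Q (q / y)\<close>.  That last series needs \<open>norm y > norm q\<close>.
\<close>

lemma jacobi_triple_annulus:
  assumes y: "norm y > r"
  shows "theta y = Q q * Q y * Q (q / y)"
proof -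
  have y0: "y \<noteq> 0" using y r_bounds(1) by force
  define f where "f = (\<lambda>(n, m). tau n * y powi n * (eps m * q ^ m * (q powi n) ^ m))"
  obtain M where M: "M > 0" "\<And>n. norm (eps n) \<le> M * gauss_power r n" using eps_bound by blast
  have summ: "f abs_summable_on UNIV"
  proof (rule abs_summable_on_int_prod)
    have p: "(\<lambda>(n, m). (tau (int n) * y powi int n) * (eps m * q ^ m)) abs_summable_on UNIV"
      by (rule abs_summable_on_prod[OF _ euler_abs_summable])
         (use summable_on_gauss[of "norm y" 1] in \<open>simp add: norm_mult norm_tau_nat norm_power\<close>)
    show "(\<lambda>(n, z). f (int n, z)) abs_summable_on UNIV"
    proof (rule Infinite_Sum.abs_summable_on_comparison_test'[OF p], safe)
      fix n m
      have "norm (f (int n, m)) = norm (tau (int n) * y powi int n * (eps m * q ^ m)) * (r ^ n) ^ m"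
        by (simp add: f_def norm_mult norm_power mult_ac)
      also have "\<dots> \<le> norm (tau (int n) * y powi int n * (eps m * q ^ m)) * 1"
        by (intro mult_left_mono power_le_one) auto
      finally show "norm (f (int n, m)) \<le> norm (tau (int n) * y powi int n * (eps m * q ^ m))" by simp
    qed
    have p: "(\<lambda>nm. M * (\<lambda>(i, m). gauss_power r i * (r / norm y) ^ i * (gauss_power r m * (r / r ^ i) ^ m)) nm) summable_on UNIV"
      by (intro summable_on_cmult_right summable_on_gauss_pair) (use y y0 r_bounds in \<open>auto simp: field_simps\<close>)
    show "(\<lambda>(n, z). f (- int n, z)) abs_summable_on UNIV"
    proof (rule Infinite_Sum.abs_summable_on_comparison_test'[OF p], safe)
      fix n m
      have "norm (f (- int n, m)) = norm (eps m) * (gauss_power r n * (r / norm y) ^ n * (r / r ^ n) ^ m)"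
        by (simp add: f_def norm_mult norm_power norm_tau_neg power_int_minus norm_inverse power_divide
             power_mult_distrib divide_inverse mult_ac power_inverse)
      also have "\<dots> \<le> M * gauss_power r m * (gauss_power r n * (r / norm y) ^ n * (r / r ^ n) ^ m)"
        using M gauss_power_pos[of r n] by (intro mult_right_mono) (auto simp: less_imp_le q_nz)
      finally show "norm (f (- int n, m)) \<le> M * (gauss_power r n * (r / norm y) ^ n * (gauss_power r m * (r / r ^ n) ^ m))"
        by (simp add: mult_ac)
    qed
  qed
  have 1: "((\<lambda>m. f (n, m)) has_sum (tau n * y powi n * Q (q * q powi n))) UNIV" for n
  proof -
    have "f (n, m) = tau n * y powi n * (eps m * (q * q powi n) ^ m)" for m
      by (simp add: f_def power_mult_distrib)
    thus ?thesis by (auto intro: has_sum_cmult_right euler)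
  qed
  have 2: "((\<lambda>n. f (n, m)) has_sum (theta y * ((q / y) ^ m / poch q m))) UNIV" for m
  proof -
    have qq: "(q ^ m) powi n = (q powi n) ^ m" for n
      by (metis power_int_mult power_int_of_nat mult.commute)
    have "f (n, m) = eps m * q ^ m * (tau n * (y * q powi int m) powi n)" for n
      unfolding f_def by (simp add: power_int_mult_distrib qq mult_ac)
    moreover have "((\<lambda>n. eps m * q ^ m * (tau n * (y * q powi int m) powi n)) has_sum
        (eps m * q ^ m * theta (y * q powi int m))) UNIV"
      by (intro has_sum_cmult_right has_sum_theta)
    moreover have "eps m * q ^ m * theta (y * q powi int m) = theta y * ((q / y) ^ m / poch q m)"
      using theta_shift[OF y0, of "int m"] y0 q_nz
      by (simp add: tau_nat eps_def power_divide field_simps)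
    ultimately show ?thesis by simp
  qed
  have small: "norm (q / y) < 1" using y y0 by (simp add: norm_divide field_simps)
  have 3: "((\<lambda>m. theta y * ((q / y) ^ m / poch q m)) has_sum (theta y * (1 / Q (q / y)))) UNIV"
    using qbinomial[OF small, of 0] by (intro has_sum_cmult_right) simp
  have A: "((\<lambda>n. tau n * y powi n * Q (q * q powi n)) has_sum (theta y * (1 / Q (q / y)))) UNIV"
    by (rule has_sum_fubini[OF summ 1 2 3])
  have "((\<lambda>n. Q q * (eps n * y ^ n)) has_sum (Q q * Q y)) UNIV"
    by (intro has_sum_cmult_right euler)
  also have "(\<lambda>n. Q q * (eps n * y ^ n)) = (\<lambda>n. tau (int n) * y powi int n * Q (q * q powi int n))"
  proof
    fix n
    have "Q q * (eps n * y ^ n) = Q (q * q ^ n) * poch q n * (eps n * y ^ n)"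
      using Q_split[of q n] by simp
    thus "Q q * (eps n * y ^ n) = tau (int n) * y powi int n * Q (q * q powi int n)"
      using poch_nonzero[OF Q_q_nonzero, of n] by (simp add: eps_def tau_nat)
  qed
  also have "(\<dots> has_sum (Q q * Q y)) UNIV \<longleftrightarrow>
      ((\<lambda>n. tau n * y powi n * Q (q * q powi n)) has_sum (Q q * Q y)) (range int)"
    by (subst has_sum_reindex) (auto simp: o_def)
  also have "\<dots> \<longleftrightarrow> ((\<lambda>n. tau n * y powi n * Q (q * q powi n)) has_sum (Q q * Q y)) UNIV"
  proof (rule has_sum_cong_neutral)
    fix n :: int assume "n \<in> UNIV - range int"
    hence "n < 0" by (metis DiffD2 nonneg_int_cases not_le rangeI)
    then obtain k where n: "n = - int (Suc k)" by (metis negD)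
    have "q * q powi n * q ^ k = 1"
      unfolding n powi_neg using q_nz by simp
    hence "Q (q * q powi n) = 0" using Q_eq_0_iff by blast
    thus "tau n * y powi n * Q (q * q powi n) = 0" by simp
  qed auto
  finally have "Q q * Q y = theta y * (1 / Q (q / y))"
    using A has_sum_unique by blast
  thus ?thesis using Q_nonzero_small[OF small] by (simp add: field_simps)
qed

text \<open>
  Both sides are divided by \<open>- y\<close> when \<open>y\<close> is replaced by \<open>y q\<close>, so the identity spreads from the
  region \<open>norm y > norm q\<close> to all \<open>y \<noteq> 0\<close>.
\<close>

lemma jacobi_triple:
  assumes "y \<noteq> 0"
  shows "theta y = Q q * Q y * Q (q / y)"
proof -
  have "\<forall>y::complex. y \<noteq> 0 \<longrightarrow> r ^ Suc n < norm y \<longrightarrow> theta y = Q q * Q y * Q (q / y)" for n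
  proof (induction n)
    case 0 thus ?case using jacobi_triple_annulus by auto
  next
    case (Suc n)
    show ?case
    proof safe
      fix y :: complex assume y: "y \<noteq> 0" "r ^ Suc (Suc n) < norm y"
      define w where "w = y / q"
      have w: "w \<noteq> 0" "y = w * q" using y q_nz by (auto simp: w_def)
      have "r ^ Suc n < norm w" using y q_nz by (simp add: w_def norm_divide field_simps)
      hence IH: "theta w = Q q * Q w * Q (q / w)" using Suc w by blast
      have a: "Q w = (1 - w) * Q y" using Q_step[of w] w by simp
      have "Q (q / y) = Q (1 / w)" using w q_nz by simp
      also have "\<dots> = (1 - 1 / w) * Q (q / w)" using Q_step[of "1 / w"] by simp
      finally have b: "Q (q / y) = (1 - 1 / w) * Q (q / w)" .
      have "- w * theta y = Q q * ((1 - w) * Q y) * Q (q / w)"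
        using theta_step[OF w(1)] IH a w by simp
      thus "theta y = Q q * Q y * Q (q / y)" unfolding b using w(1) by (simp add: field_simps)
    qed
  qed
  moreover obtain n where "r ^ n < norm y"
    using real_arch_pow_inv[of "norm y" r] assms by auto
  moreover have "r ^ Suc n \<le> r ^ n" by (simp add: mult_left_le_one_le)
  ultimately show ?thesis using assms by (meson le_less_trans)
qed

section \<open>Partial fractions of a product of two reciprocal infinite products\<close>

text \<open>
  The \<open>n\<close>-th term carries the poles \<open>\<beta> = q\<^bsup>-n\<^esup>\<close> and \<open>u = q\<^bsup>-n\<^esup>\<close> of \<open>Q q Q (\<beta> u) / (Q \<beta> Q u)\<close>.  The
  bracket equals \<open>(1 - \<beta> u q\<^bsup>2n\<^esup>) / ((1 - \<beta> q\<^sup>n) (1 - u q\<^sup>n))\<close>, so the series is very well poised.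
\<close>

definition pfrac_term :: "complex \<Rightarrow> complex \<Rightarrow> nat \<Rightarrow> complex"
  where "pfrac_term \<beta> u n = poch (\<beta> * u) n * (eps n * q ^ n) * (1 / (1 - \<beta> * q ^ n) + 1 / (1 - u * q ^ n) - 1)"

lemma summable_eps: "summable (\<lambda>n. norm (eps n * q ^ n))"
  using qbinomial_summable[of 0 q] by (simp only: euler_coeff norm_zero zero_less_one)

lemma summable_norm_pfrac_term:
  assumes "Q \<beta> \<noteq> 0" "Q u \<noteq> 0"
  shows "summable (\<lambda>n. norm (pfrac_term \<beta> u n))"
proof -
  obtain M where M: "M > 0" "\<And>n. norm (poch (\<beta> * u) n) \<le> M" using poch_bounded by blast
  obtain M1 where M1: "M1 > 0" "\<And>n. norm (inverse (1 - \<beta> * q ^ n)) \<le> M1"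
    using one_minus_inverse_bounded[OF assms(1)] by blast
  obtain M2 where M2: "M2 > 0" "\<And>n. norm (inverse (1 - u * q ^ n)) \<le> M2"
    using one_minus_inverse_bounded[OF assms(2)] by blast
  show ?thesis
  proof (rule summable_comparison_test'[where N = 0])
    show "summable (\<lambda>n. M * norm (eps n * q ^ n) * (M1 + M2 + 1))"
      by (intro summable_mult summable_mult2 summable_eps)
    fix n
    have "norm (1 / (1 - \<beta> * q ^ n) + 1 / (1 - u * q ^ n) - 1) \<le> M1 + M2 + 1"
      using M1(2)[of n] M2(2)[of n]
      by (intro order.trans[OF norm_triangle_ineq4] add_mono order.trans[OF norm_triangle_ineq])
         (auto simp: divide_inverse)
    thus "norm (norm (pfrac_term \<beta> u n)) \<le> M * norm (eps n * q ^ n) * (M1 + M2 + 1)"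
      unfolding pfrac_term_def norm_mult real_norm_def abs_mult abs_norm_cancel using M by (intro mult_mono) auto
  qed
qed

definition pfrac :: "complex \<Rightarrow> complex \<Rightarrow> complex"
  where "pfrac \<beta> u = (\<Sum>n. pfrac_term \<beta> u n)"

lemma pfrac_sums:
  assumes "Q \<beta> \<noteq> 0" "Q u \<noteq> 0"
  shows "pfrac_term \<beta> u sums pfrac \<beta> u"
  unfolding pfrac_def by (rule summable_sums[OF summable_norm_cancel[OF summable_norm_pfrac_term[OF assms]]])

lemma pfrac_commute: "pfrac \<beta> u = pfrac u \<beta>"
  by (simp add: pfrac_def pfrac_term_def mult.commute add.commute)

text \<open>
  The difference of the two sides telescopes.  The fractions in \<open>\<beta>\<close> combine to the constant \<open>- u\<close>,
  because \<open>(1 - u) - (1 - \<beta> u q\<^sup>n) = - u (1 - \<beta> q\<^sup>n)\<close>, and the fractions in \<open>u\<close> leave \<open>G n - G (n + 1)\<close>.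
\<close>

lemma pfrac_step:
  assumes "Q \<beta> \<noteq> 0" "Q u \<noteq> 0"
  shows "(1 - u) * pfrac \<beta> u = (1 - \<beta> * u) * pfrac \<beta> (u * q)"
proof -
  \<comment> \<open>The identity \<open>(1 - u) u q\<^sup>n / (1 - u q\<^sup>n) = u + u (q\<^sup>n - 1) / (1 - u q\<^sup>n)\<close> and the recurrence
    of \<open>eps\<close> suggest \<open>G\<close>; it vanishes at \<open>n = 0\<close> because of the factor \<open>q\<^sup>n - 1\<close>.\<close>
  define G where "G = (\<lambda>n. u * (poch (\<beta> * u) n * (eps n * q ^ n) * (q ^ n - 1) * (1 / (1 - u * q ^ n))))"
  have Quq: "Q (u * q) \<noteq> 0" using Q_nonzero_shift[OF assms(2), of 1] by simp
  have G: "(1 - u) * pfrac_term \<beta> u n - (1 - \<beta> * u) * pfrac_term \<beta> (u * q) n = G n - G (Suc n)" for n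
  proof -
    define s B E where "s = q ^ n" and "B = poch (\<beta> * u) n" and "E = eps n * q ^ n"
    have nz: "1 - \<beta> * s \<noteq> 0" "1 - u * s \<noteq> 0" "1 - u * q * s \<noteq> 0"
      using one_minus_shift_nonzero[OF assms(1), of n] one_minus_shift_nonzero[OF assms(2), of n]
        one_minus_shift_nonzero[OF Quq, of n] by (auto simp: s_def)
    have e1: "(1 - \<beta> * u) * poch (\<beta> * (u * q)) n = B * (1 - \<beta> * u * s)"
      using poch_Suc_left[of "\<beta> * u" n] by (simp add: poch_Suc B_def s_def mult_ac)
    have "eps (Suc n) * q ^ Suc n * (q ^ Suc n - 1) = - (eps (Suc n) * (1 - q ^ Suc n)) * q ^ Suc n"
      by (simp add: algebra_simps)
    also have "\<dots> = E * (q * s)"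
      unfolding eps_Suc by (simp add: E_def s_def)
    finally have e2: "eps (Suc n) * q ^ Suc n * (q ^ Suc n - 1) = E * (q * s)" .
    have GS: "G (Suc n) = u * (B * (1 - \<beta> * u * s) * (E * (q * s)) * (1 / (1 - u * q * s)))"
    proof -
      have "G (Suc n) = u * (poch (\<beta> * u) (Suc n) * (eps (Suc n) * q ^ Suc n * (q ^ Suc n - 1)) * (1 / (1 - u * q ^ Suc n)))"
        unfolding G_def by (simp only: mult.assoc)
      thus ?thesis unfolding e2 by (simp add: poch_Suc B_def s_def mult.assoc)
    qed
    have G0: "G n = u * (B * E * (s - 1) * (1 / (1 - u * s)))"
      by (simp add: G_def B_def E_def s_def)
    have t1: "pfrac_term \<beta> u n = B * E * (1 / (1 - \<beta> * s) + 1 / (1 - u * s) - 1)"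
      by (simp add: pfrac_term_def B_def E_def s_def)
    have t2: "(1 - \<beta> * u) * pfrac_term \<beta> (u * q) n = B * (1 - \<beta> * u * s) * E * (1 / (1 - \<beta> * s) + 1 / (1 - u * q * s) - 1)"
      unfolding pfrac_term_def mult.assoc[symmetric] using e1
      by (simp add: E_def s_def mult.assoc)
    have a: "(1 - u) * (1 / (1 - \<beta> * s)) - (1 - \<beta> * u * s) * (1 / (1 - \<beta> * s)) = - u"
      using nz(1) by (simp add: divide_simps) (simp add: algebra_simps)
    have b: "(1 - u) * (1 / (1 - u * s) - 1) = u + u * (s - 1) * (1 / (1 - u * s))"
      using nz(2) by (simp add: divide_simps) (simp add: algebra_simps)
    have c: "1 / (1 - u * q * s) - 1 = u * (q * s) * (1 / (1 - u * q * s))"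
      using nz(3) by (simp add: divide_simps)
    have "(1 - u) * pfrac_term \<beta> u n - (1 - \<beta> * u) * pfrac_term \<beta> (u * q) n
       = B * E * (((1 - u) * (1 / (1 - \<beta> * s)) - (1 - \<beta> * u * s) * (1 / (1 - \<beta> * s)))
           + (1 - u) * (1 / (1 - u * s) - 1) - (1 - \<beta> * u * s) * (1 / (1 - u * q * s) - 1))"
    proof -
      define D V W where "D = 1 / (1 - \<beta> * s)" and "V = 1 / (1 - u * s)" and "W = 1 / (1 - u * q * s)"
      show ?thesis unfolding t1 t2 D_def[symmetric] V_def[symmetric] W_def[symmetric]
        by (simp add: algebra_simps)
    qed
    also have "\<dots> = G n - G (Suc n)"
    proof -
      define V W where "V = 1 / (1 - u * s)" and "W = 1 / (1 - u * q * s)"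
      show ?thesis unfolding a b c GS G0 unfolding V_def[symmetric] W_def[symmetric]
        by (simp add: algebra_simps)
    qed
    finally show ?thesis .
  qed
  have "G \<longlonglongrightarrow> 0"
  proof -
    obtain M where M: "M > 0" "\<And>n. norm (poch (\<beta> * u) n) \<le> M" using poch_bounded by blast
    obtain M2 where M2: "M2 > 0" "\<And>n. norm (inverse (1 - u * q ^ n)) \<le> M2"
      using one_minus_inverse_bounded[OF assms(2)] by blast
    have "(\<lambda>n. norm u * (M * norm (eps n * q ^ n) * 2 * M2)) \<longlonglongrightarrow> norm u * (M * 0 * 2 * M2)"
      by (intro tendsto_intros summable_LIMSEQ_zero summable_eps)
    hence lim: "(\<lambda>n. norm u * (M * norm (eps n * q ^ n) * 2 * M2)) \<longlonglongrightarrow> 0" by simp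
    have bound: "norm (G n) \<le> norm u * (M * norm (eps n * q ^ n) * 2 * M2)" for n
    proof -
      have "norm (q ^ n - 1) \<le> norm (q ^ n) + norm (1 :: complex)" by (rule norm_triangle_ineq4)
      also have "\<dots> \<le> 2" by (simp add: norm_power power_le_one)
      finally show ?thesis unfolding G_def norm_mult[of u] norm_mult[of _ "1 / _"] norm_mult[of _ "_ - _"] norm_mult[of "poch _ _"]
        using M M2 by (intro mult_mono mult_nonneg_nonneg) (auto simp: divide_inverse)
    qed
    show ?thesis
      by (rule Lim_null_comparison[OF always_eventually[OF allI[OF bound]] lim])
  qed
  from telescope_sums'[OF this] have "(\<lambda>n. G n - G (Suc n)) sums 0"
    by (simp add: G_def)
  moreover have "(\<lambda>n. (1 - u) * pfrac_term \<beta> u n - (1 - \<beta> * u) * pfrac_term \<beta> (u * q) n) sums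
      ((1 - u) * pfrac \<beta> u - (1 - \<beta> * u) * pfrac \<beta> (u * q))"
    by (intro sums_diff sums_mult pfrac_sums assms Quq)
  ultimately have "(1 - u) * pfrac \<beta> u - (1 - \<beta> * u) * pfrac \<beta> (u * q) = 0"
    unfolding G using sums_unique2 by blast
  thus ?thesis by simp
qed

text \<open>
  Symmetry in \<open>\<beta>\<close> and \<open>u\<close> allows \<open>pfrac_step\<close> to be applied to both variables in turn.
\<close>

lemma pfrac_iterate:
  assumes "Q \<beta> \<noteq> 0" "Q u \<noteq> 0"
  shows "poch \<beta> N * poch u N * pfrac \<beta> u = poch (\<beta> * u) (2 * N) * pfrac (\<beta> * q ^ N) (u * q ^ N)"
proof (induction N)
  case (Suc N)
  define b v where "b = \<beta> * q ^ N" and "v = u * q ^ N"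
  have nz: "Q b \<noteq> 0" "Q v \<noteq> 0" unfolding b_def v_def by (rule Q_nonzero_shift[OF assms(1)], rule Q_nonzero_shift[OF assms(2)])
  have nz': "Q (v * q) \<noteq> 0" using Q_nonzero_shift[OF nz(2), of 1] by simp
  have "(1 - b) * ((1 - v) * pfrac b v) = (1 - b * v) * ((1 - b) * pfrac (v * q) b)"
    unfolding pfrac_step[OF nz] by (simp add: pfrac_commute)
  also have "\<dots> = (1 - b * v) * ((1 - b * v * q) * pfrac (b * q) (v * q))"
    unfolding pfrac_step[OF nz' nz(1)] by (simp add: pfrac_commute mult_ac)
  finally have step: "(1 - b) * ((1 - v) * pfrac b v) = (1 - b * v) * ((1 - b * v * q) * pfrac (b * q) (v * q))" .
  have "poch \<beta> (Suc N) * poch u (Suc N) * pfrac \<beta> u = (1 - b) * (1 - v) * (poch \<beta> N * poch u N * pfrac \<beta> u)"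
    by (simp add: poch_Suc b_def v_def)
  also have "\<dots> = poch (\<beta> * u) (2 * N) * ((1 - b) * ((1 - v) * pfrac b v))"
    unfolding Suc by (simp add: b_def v_def)
  also have "\<dots> = poch (\<beta> * u) (2 * N) * (1 - b * v) * (1 - b * v * q) * pfrac (b * q) (v * q)"
    unfolding step by simp
  also have "poch (\<beta> * u) (2 * N) * (1 - b * v) * (1 - b * v * q) = poch (\<beta> * u) (2 * Suc N)"
    by (simp add: poch_Suc b_def v_def power_add mult_2 mult_2_right mult_ac)
  also have "pfrac (b * q) (v * q) = pfrac (\<beta> * q ^ Suc N) (u * q ^ Suc N)"
    by (simp add: b_def v_def mult_ac)
  finally show ?case .
qed simp

text \<open>
  Termwise, \<open>pfrac\<close> at \<open>(0, 0)\<close> is Euler's series for \<open>Q q\<close>; dominated convergence justifies the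
  limit.  The shifted factorials are bounded uniformly in \<open>N\<close> because they are quotients
  \<open>(\<beta> u;q)\<^bsub>2N+n\<^esub> / (\<beta> u;q)\<^bsub>2N\<^esub>\<close>.
\<close>

lemma pfrac_limit:
  assumes "Q \<beta> \<noteq> 0" "Q u \<noteq> 0" "Q (\<beta> * u) \<noteq> 0"
  shows "(\<lambda>N. pfrac (\<beta> * q ^ N) (u * q ^ N)) \<longlonglongrightarrow> Q q"
proof -
  obtain M where M: "M > 0" "\<And>n. norm (poch (\<beta> * u) n) \<le> M" using poch_bounded by blast
  obtain M' where M': "M' > 0" "\<And>n. norm (inverse (poch (\<beta> * u) n)) \<le> M'"
    using poch_inverse_bounded[OF assms(3)] by blast
  obtain M1 where M1: "M1 > 0" "\<And>n. norm (inverse (1 - \<beta> * q ^ n)) \<le> M1"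
    using one_minus_inverse_bounded[OF assms(1)] by blast
  obtain M2 where M2: "M2 > 0" "\<And>n. norm (inverse (1 - u * q ^ n)) \<le> M2"
    using one_minus_inverse_bounded[OF assms(2)] by blast
  define a where "a = (\<lambda>n N. pfrac_term (\<beta> * q ^ N) (u * q ^ N) n)"
  define K where "K = (\<lambda>n. M * M' * norm (eps n * q ^ n) * (M1 + M2 + 1))"
  have lim: "(\<lambda>N. a n N) \<longlonglongrightarrow> eps n * q ^ n" for n
  proof -
    have "(\<lambda>N. (\<Prod>k<n. 1 - \<beta> * q ^ N * (u * q ^ N) * q ^ k) * (eps n * q ^ n) * 
        (1 / (1 - \<beta> * q ^ N * q ^ n) + 1 / (1 - u * q ^ N * q ^ n) - 1)) \<longlonglongrightarrow>
      (\<Prod>k<n. 1 - \<beta> * 0 * (u * 0) * q ^ k) * (eps n * q ^ n) * 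
        (1 / (1 - \<beta> * 0 * q ^ n) + 1 / (1 - u * 0 * q ^ n) - 1)"
      by (intro tendsto_intros q_pow_tendsto_0) auto
    thus ?thesis by (simp add: a_def pfrac_term_def poch_def)
  qed
  have bound: "norm (a n N) \<le> K n" for n N
  proof -
    have "poch (\<beta> * u) (2 * N + n) = poch (\<beta> * u) (2 * N) * poch (\<beta> * q ^ N * (u * q ^ N)) n"
      by (induction n) (simp_all add: poch_Suc power_add mult_2 mult_2_right mult_ac)
    hence "poch (\<beta> * q ^ N * (u * q ^ N)) n = poch (\<beta> * u) (2 * N + n) * inverse (poch (\<beta> * u) (2 * N))"
      using poch_nonzero[OF assms(3), of "2 * N"] by (simp add: field_simps)
    hence p: "norm (poch (\<beta> * q ^ N * (u * q ^ N)) n) \<le> M * M'"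
      using mult_mono[OF M(2)[of "2 * N + n"] M'(2)[of "2 * N"]] M(1) by (simp add: norm_mult)
    have "norm (1 / (1 - \<beta> * q ^ N * q ^ n) + 1 / (1 - u * q ^ N * q ^ n) - 1) \<le> M1 + M2 + 1"
      using M1(2)[of "N + n"] M2(2)[of "N + n"]
      by (intro order.trans[OF norm_triangle_ineq4] add_mono order.trans[OF norm_triangle_ineq])
         (auto simp: divide_inverse power_add mult.assoc)
    thus ?thesis
      unfolding a_def pfrac_term_def norm_mult[of _ "_ - _"] norm_mult[of "poch _ _"] K_def using p M M'
      by (intro mult_mono) auto
  qed
  have "summable K" unfolding K_def by (intro summable_mult summable_mult2 summable_eps)
  from tannerys_theorem[OF lim _ this sequentially_bot] bound
  have "(\<lambda>N. \<Sum>n. a n N) \<longlonglongrightarrow> (\<Sum>n. eps n * q ^ n)" by (auto simp: case_prod_unfold)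
  moreover have "(\<lambda>n. eps n * q ^ n) sums Q q" by (rule has_sum_imp_sums[OF euler])
  ultimately show ?thesis by (simp add: a_def pfrac_def sums_iff)
qed

lemma pfrac_eq:
  assumes "Q \<beta> \<noteq> 0" "Q u \<noteq> 0" "Q (\<beta> * u) \<noteq> 0"
  shows "pfrac \<beta> u = Q q * Q (\<beta> * u) / (Q \<beta> * Q u)"
proof -
  have "(\<lambda>N. poch (\<beta> * u) (2 * N) * pfrac (\<beta> * q ^ N) (u * q ^ N)) \<longlonglongrightarrow> Q (\<beta> * u) * Q q"
  proof (intro tendsto_mult pfrac_limit assms)
    show "(\<lambda>N. poch (\<beta> * u) (2 * N)) \<longlonglongrightarrow> Q (\<beta> * u)"
      using LIMSEQ_subseq_LIMSEQ[OF poch_tendsto[of "\<beta> * u"], of "\<lambda>N. 2 * N"]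
      by (simp add: strict_mono_def o_def)
  qed
  moreover have "(\<lambda>N. poch (\<beta> * u) (2 * N) * pfrac (\<beta> * q ^ N) (u * q ^ N)) \<longlonglongrightarrow> Q \<beta> * Q u * pfrac \<beta> u"
    unfolding pfrac_iterate[OF assms(1,2), symmetric] by (intro tendsto_intros poch_tendsto)
  ultimately have "Q \<beta> * Q u * pfrac \<beta> u = Q (\<beta> * u) * Q q" using LIMSEQ_unique by blast
  thus ?thesis using assms by (simp add: field_simps)
qed

lemma pfrac_has_sum:
  assumes "Q \<beta> \<noteq> 0" "Q u \<noteq> 0" "Q (\<beta> * u) \<noteq> 0"
  shows "(pfrac_term \<beta> u has_sum (Q q * Q (\<beta> * u) / (Q \<beta> * Q u))) UNIV"
  using norm_summable_imp_has_sum[OF summable_norm_pfrac_term[OF assms(1,2)] pfrac_sums[OF assms(1,2)]]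
  unfolding pfrac_eq[OF assms] .

section \<open>Convolution of theta coefficients with simple fractions\<close>

lemma theta_nonzero_iff:
  assumes "y \<noteq> 0"
  shows "theta y \<noteq> 0 \<longleftrightarrow> Q y \<noteq> 0 \<and> Q (q / y) \<noteq> 0"
  using jacobi_triple[OF assms] by simp

lemma theta_powi_nonzero:
  assumes "y \<noteq> 0" "theta y \<noteq> 0"
  shows "theta (y * q powi n) \<noteq> 0"
  using theta_shift[OF assms(1), of n] assms(2) by auto

lemma bilateral_inverse_bounded:
  assumes "B \<noteq> 0" "theta B \<noteq> 0"
  obtains M where "M > 0" "\<And>k. norm (1 / (1 - B * q powi k)) \<le> M"
proof -
  have nz: "Q B \<noteq> 0" "Q (q / B) \<noteq> 0" using theta_nonzero_iff assms by auto
  obtain M1 where M1: "M1 > 0" "\<And>n. norm (inverse (1 - B * q ^ n)) \<le> M1"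
    using one_minus_inverse_bounded[OF nz(1)] by blast
  obtain M2 where M2: "M2 > 0" "\<And>n. norm (inverse (1 - q / B * q ^ n)) \<le> M2"
    using one_minus_inverse_bounded[OF nz(2)] by blast
  have "norm (1 / (1 - B * q powi k)) \<le> M1 + M2 + 1" for k
  proof (cases "k \<ge> 0")
    case True
    then obtain n where "k = int n" by (metis nonneg_int_cases)
    thus ?thesis using M1(2)[of n] M2(1) by (simp add: divide_inverse)
  next
    case False
    define n where "n = nat (- k - 1)"
    have k: "k = - int (Suc n)" using False by (simp add: n_def)
    have "1 / (1 - B * q powi k) = 1 - inverse (1 - q / B * q ^ n)"
      unfolding k powi_neg using assms(1) one_minus_shift_nonzero[OF nz(2), of n]
      by (simp add: field_simps)
    also have "norm \<dots> \<le> norm (1 :: complex) + norm (inverse (1 - q / B * q ^ n))"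
      by (rule norm_triangle_ineq4)
    finally show ?thesis using M2(2)[of n] M1(1) by simp
  qed
  thus ?thesis using that[of "M1 + M2 + 1"] M1 M2 by simp
qed

lemma tau_div_abs_summable:
  assumes "B \<noteq> 0" "theta B \<noteq> 0"
  shows "(\<lambda>j. tau j / (1 - B * q powi (- j))) abs_summable_on UNIV"
proof -
  obtain M where M: "M > 0" "\<And>k. norm (1 / (1 - B * q powi k)) \<le> M"
    using bilateral_inverse_bounded[OF assms] by blast
  have "(\<lambda>j. M * norm (tau j * 1 powi j)) summable_on UNIV"
    by (intro summable_on_cmult_right tau_abs_summable)
  thus ?thesis
  proof (rule Infinite_Sum.abs_summable_on_comparison_test')
    fix j
    have "norm (tau j / (1 - B * q powi (- j))) = norm (1 / (1 - B * q powi (- j))) * norm (tau j)"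
      by (simp add: norm_divide)
    also have "\<dots> \<le> M * norm (tau j)" using M by (intro mult_right_mono) auto
    finally show "norm (tau j / (1 - B * q powi (- j))) \<le> M * norm (tau j * 1 powi j)" by simp
  qed
qed

text \<open>
  Folding the bilateral sum at \<open>j \<mapsto> 1 - j\<close> pairs the terms \<open>- n\<close> and \<open>1 + n\<close>.  Each pair is the \<open>n\<close>-th
  partial fraction term for \<open>\<beta> = B\<close> and \<open>u = q / B\<close>, a choice for which \<open>\<beta> u = q\<close>.
\<close>

lemma tau_div_has_sum_0:
  assumes "B \<noteq> 0" "theta B \<noteq> 0"
  shows "((\<lambda>j. tau j / (1 - B * q powi (- j))) has_sum (Q q ^ 3 / theta B)) UNIV"
proof -
  define f where "f = (\<lambda>j. tau j / (1 - B * q powi (- j)))"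
  have nz: "Q B \<noteq> 0" "Q (q / B) \<noteq> 0" using theta_nonzero_iff assms by auto
  have f: "f summable_on UNIV"
    unfolding f_def by (rule abs_summable_summable[OF tau_div_abs_summable[OF assms]])
  obtain a where a: "(f has_sum a) (range (\<lambda>n. - int n))"
    using summable_on_subset_banach[OF f, of "range (\<lambda>n. - int n)"] by (auto simp: summable_on_def)
  obtain b where b: "(f has_sum b) (range (\<lambda>n. 1 + int n))"
    using summable_on_subset_banach[OF f, of "range (\<lambda>n. 1 + int n)"] by (auto simp: summable_on_def)
  have a': "((\<lambda>n. f (- int n)) has_sum a) UNIV"
    using a by (subst (asm) has_sum_reindex) (auto simp: o_def inj_on_def)
  have b': "((\<lambda>n. f (1 + int n)) has_sum b) UNIV"
    using b by (subst (asm) has_sum_reindex) (auto simp: o_def inj_on_def)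
  have "f (- int n) + f (1 + int n) = pfrac_term B (q / B) n" for n
  proof -
    have t: "poch (B * (q / B)) n * (eps n * q ^ n) = tau (- int n)"
      using assms(1) poch_nonzero[OF Q_q_nonzero, of n] by (simp add: eps_def tau_uminus tau_nat)
    have t2: "tau (1 + int n) = - tau (- int n)"
      using tau_reflect[of "- int n"] by simp
    have e: "q powi (- (1 + int n)) = 1 / (q * q ^ n)"
      using powi_neg[of q "Suc n"] by simp
    have "1 / (1 - B * q powi (- (1 + int n))) = 1 - 1 / (1 - q / B * q ^ n)"
      unfolding e using assms(1) one_minus_shift_nonzero[OF nz(2), of n] by (simp add: field_simps)
    note e2 = this
    have "f (1 + int n) = - tau (- int n) * (1 / (1 - B * q powi (- (1 + int n))))"
      unfolding f_def t2 by simp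
    also have "\<dots> = tau (- int n) * (1 / (1 - q / B * q ^ n) - 1)"
      unfolding e2 by (simp add: algebra_simps)
    finally have "f (1 + int n) = tau (- int n) * (1 / (1 - q / B * q ^ n) - 1)" .
    thus ?thesis unfolding pfrac_term_def t by (simp add: f_def algebra_simps)
  qed
  hence "(pfrac_term B (q / B) has_sum (a + b)) UNIV"
    using has_sum_add[OF a' b'] by simp
  moreover have "(pfrac_term B (q / B) has_sum (Q q * Q (B * (q / B)) / (Q B * Q (q / B)))) UNIV"
    using nz assms by (intro pfrac_has_sum) auto
  ultimately have "a + b = Q q * Q (B * (q / B)) / (Q B * Q (q / B))"
    by (rule has_sum_unique)
  hence ab: "a + b = Q q ^ 3 / theta B"
    using assms by (simp add: jacobi_triple power3_eq_cube)
  have "(f has_sum (a + b)) (range (\<lambda>n. - int n) \<union> range (\<lambda>n. 1 + int n))"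
    by (intro has_sum_Un_disjoint a b) auto
  moreover have "range (\<lambda>n. - int n) \<union> range (\<lambda>n. 1 + int n) = UNIV"
  proof (intro equalityI subsetI)
    fix k :: int
    show "k \<in> range (\<lambda>n. - int n) \<union> range (\<lambda>n. 1 + int n)"
    proof (cases "k \<le> 0")
      case True
      hence "k = - int (nat (- k))" by simp
      thus ?thesis by blast
    next
      case False
      hence "k = 1 + int (nat (k - 1))" by simp
      thus ?thesis by blast
    qed
  qed auto
  ultimately show ?thesis by (simp add: ab f_def)
qed

text \<open>
  The shift by \<open>n\<close> replaces \<open>B\<close> by \<open>B q\<^sup>n\<close>, and \<open>theta\<close> is quasi-periodic.
\<close>

lemma tau_div_has_sum:
  assumes "B \<noteq> 0" "theta B \<noteq> 0"
  shows "((\<lambda>j. tau j / (1 - B * q powi (n - j))) has_sum (tau n * B powi n * (Q q ^ 3 / theta B))) UNIV"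
proof -
  have "((\<lambda>j. tau j / (1 - B * q powi n * q powi (- j))) has_sum (Q q ^ 3 / theta (B * q powi n))) UNIV"
    using assms by (intro tau_div_has_sum_0 theta_powi_nonzero) auto
  moreover have "B * q powi n * q powi (- j) = B * q powi (n - j)" for j
    using power_int_add[of q n "- j"] by (simp add: mult.assoc)
  moreover have "Q q ^ 3 / theta (B * q powi n) = tau n * B powi n * (Q q ^ 3 / theta B)"
    using theta_shift[OF assms(1), of n] assms theta_powi_nonzero[OF assms, of n]
    by (simp add: field_simps)
  ultimately show ?thesis by simp
qed

text \<open>
  The reflection \<open>j \<mapsto> 1 - j\<close> of \<open>tau_div_has_sum\<close>.
\<close>

lemma tau_div_has_sum':
  assumes "B \<noteq> 0" "theta B \<noteq> 0"
  shows "((\<lambda>j. tau j / (1 - B * q powi (n + j))) has_sum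
     (- (tau (n + 1) * B powi (n + 1) * (Q q ^ 3 / theta B)))) UNIV"
proof -
  have "((\<lambda>j. - (tau j / (1 - B * q powi (n + 1 - j)))) has_sum
     (- (tau (n + 1) * B powi (n + 1) * (Q q ^ 3 / theta B)))) UNIV"
    by (intro has_sum_uminusI tau_div_has_sum assms)
  also have "(\<lambda>j. - (tau j / (1 - B * q powi (n + 1 - j)))) =
     (\<lambda>j. (\<lambda>j. tau j / (1 - B * q powi (n + j))) (1 - j))"
    by (auto simp: fun_eq_iff tau_reflect algebra_simps)
  finally show ?thesis by (rule iffD1[OF has_sum_reindex_bij_betw[OF bij_diff_int]])
qed

section \<open>Closed form of the base series\<close>

text \<open>
  The numerators in the partial fraction expansion when \<open>\<beta>\<close> stands for the product of both
  arguments; they recur as the Taylor coefficients of \<open>Phi\<close>.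
\<close>

definition rho :: "complex \<Rightarrow> nat \<Rightarrow> complex"
  where "rho \<beta> i = poch \<beta> i * (eps i * q ^ i)"

definition Phi :: "complex \<Rightarrow> complex \<Rightarrow> complex"
  where "Phi \<beta> w = (\<Sum>\<^sub>\<infinity>i. rho \<beta> i * w ^ i)"

lemma rho_abs_summable: "(\<lambda>i. rho \<beta> i * w ^ i) abs_summable_on UNIV"
proof -
  obtain M where M: "M > 0" "\<And>n. norm (poch \<beta> n) \<le> M" using poch_bounded by blast
  have "(\<lambda>i. M * norm (eps i * (q * w) ^ i)) summable_on UNIV"
    by (intro summable_on_cmult_right euler_abs_summable)
  thus ?thesis
  proof (rule Infinite_Sum.abs_summable_on_comparison_test')
    fix i
    have "norm (rho \<beta> i * w ^ i) = norm (poch \<beta> i) * norm (eps i * (q * w) ^ i)"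
      by (simp add: rho_def norm_mult power_mult_distrib mult_ac)
    also have "\<dots> \<le> M * norm (eps i * (q * w) ^ i)" using M by (intro mult_right_mono) auto
    finally show "norm (rho \<beta> i * w ^ i) \<le> M * norm (eps i * (q * w) ^ i)" .
  qed
qed

lemma Phi_has_sum: "((\<lambda>i. rho \<beta> i * w ^ i) has_sum Phi \<beta> w) UNIV"
  unfolding Phi_def by (rule has_sum_infsum[OF abs_summable_summable[OF rho_abs_summable]])

definition psi :: "complex \<Rightarrow> complex \<Rightarrow> complex \<Rightarrow> complex"
  where "psi b p y = (\<Sum>\<^sub>\<infinity>k. psi_coeff b p k * y powi k)"

lemma psi_has_sum:
  assumes "b \<noteq> 0" "p \<noteq> 0" "theta p \<noteq> 0" "Q (q / b) \<noteq> 0"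
  shows "((\<lambda>k. psi_coeff b p k * y powi k) has_sum psi b p y) UNIV"
  unfolding psi_def using assms theta_nonzero_iff[of p]
  by (intro has_sum_infsum[OF abs_summable_summable[OF psi_coeff_abs_summable]]) auto

text \<open>
  Compare coefficients of \<open>y\<^sup>N\<close> in \<open>theta y * psi b p y\<close>.  The coefficient is the convolution of
  \<open>tau\<close> with \<open>psi_coeff\<close>.  By partial fractions at \<open>\<beta> = b q\<^bsup>N-j\<^esup>\<close>, \<open>u = p q\<^bsup>j-N\<^esup>\<close>, whose product
  \<open>b p\<close> does not depend on \<open>j\<close>, it is a sum over \<open>i\<close> of convolutions of \<open>tau\<close> with simple fractions.
  These give \<open>tau (N + i) b\<^bsup>N+i\<^esup>\<close> and \<open>tau (i - N + 1) p\<^bsup>i-N+1\<^esup>\<close>, the coefficients of the two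
  products on the right-hand side.
\<close>

lemma psi_generic:
  assumes "b \<noteq> 0" "p \<noteq> 0" "y \<noteq> 0" "theta b \<noteq> 0" "theta p \<noteq> 0" "Q (b * p) \<noteq> 0"
  shows "theta y * psi b p y * Q (b * p) =
    Q q / Q (q / b) * theta (b * y) * Phi (b * p) (1 / y)
    - Q b * Q q ^ 2 / theta p * y * theta (p / y) * Phi (b * p) y"
proof -
  have bnz: "Q b \<noteq> 0" "Q (q / b) \<noteq> 0" and pnz: "Q p \<noteq> 0" "Q (q / p) \<noteq> 0"
    using theta_nonzero_iff assms by auto
  define Cb Cp where "Cb = Q q ^ 3 / theta b" and "Cp = Q q ^ 3 / theta p"
  define \<kappa> where "\<kappa> = Q b / (Q q * Q (b * p))"
  have bk: "Q (b * q powi k) \<noteq> 0" and pk: "Q (p * q powi k) \<noteq> 0" for k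
    using theta_powi_nonzero[OF assms(1,4), of k] theta_powi_nonzero[OF assms(2,5), of k]
      theta_nonzero_iff assms(1,2) by auto
  have bp: "b * q powi k * (p * q powi (- k)) = b * p" for k
    by (simp add: power_int_minus)
  have coeff_pfrac: "(pfrac_term (b * q powi k) (p * q powi (- k)) has_sum (psi_coeff b p k / \<kappa>)) UNIV" for k
  proof -
    have "psi_coeff b p k = Q b / Q (b * q powi k) / Q (p * q powi (- k))"
      unfolding psi_coeff_def by (subst qpoch_eq_quotient) (use bk q_lt_1 in auto)
    hence "psi_coeff b p k / \<kappa> = Q q * Q (b * p) / (Q (b * q powi k) * Q (p * q powi (- k)))"
      using bnz assms by (simp add: \<kappa>_def)
    thus ?thesis using pfrac_has_sum[of "b * q powi k" "p * q powi (- k)", unfolded bp] bk pk assms(6) by simp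
  qed
  define co where "co = (\<lambda>N i. rho (b * p) i * (tau (N + int i) * b powi (N + int i) * Cb
        - tau (int i - N + 1) * p powi (int i - N + 1) * Cp))"

  have coeff: "\<exists>S. ((\<lambda>j. tau j * (psi_coeff b p (N - j) / \<kappa>)) has_sum S) UNIV \<and> (co N has_sum S) UNIV" for N
  proof -
    define f where "f = (\<lambda>(j, i). tau j * pfrac_term (b * q powi (N - j)) (p * q powi (- (N - j))) i)"
    have f: "f (j, i) = rho (b * p) i * (tau j / (1 - b * q powi (N + int i - j))
         + tau j / (1 - p * q powi (int i - N + j)) - tau j)" for i j
    proof -
      have e1: "b * q powi (N - j) * q ^ i = b * q powi (N + int i - j)"
        using power_int_add[of q "N - j" "int i"] by (simp add: algebra_simps)
      have e2: "p * q powi (- (N - j)) * q ^ i = p * q powi (int i - N + j)"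
        using power_int_add[of q "- (N - j)" "int i"] by (simp add: algebra_simps)
      show ?thesis unfolding f_def case_prod_conv pfrac_term_def bp e1 e2 rho_def
        by (simp add: algebra_simps)
    qed
    obtain M1 where M1: "M1 > 0" "\<And>k. norm (1 / (1 - b * q powi k)) \<le> M1"
      using bilateral_inverse_bounded[OF assms(1,4)] by blast
    obtain M2 where M2: "M2 > 0" "\<And>k. norm (1 / (1 - p * q powi k)) \<le> M2"
      using bilateral_inverse_bounded[OF assms(2,5)] by blast
    have "(\<lambda>x. (M1 + M2 + 1) * norm ((\<lambda>(j, i). (tau j * 1 powi j) * (rho (b * p) i * 1 ^ i)) x)) summable_on UNIV"
      by (intro summable_on_cmult_right abs_summable_on_prod tau_abs_summable rho_abs_summable)
    hence summ: "f abs_summable_on UNIV"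
    proof (rule Infinite_Sum.abs_summable_on_comparison_test', safe)
      fix j i
      define D V where "D = 1 / (1 - b * q powi (N + int i - j))" and "V = 1 / (1 - p * q powi (int i - N + j))"
      have "f (j, i) = (D + V - 1) * (tau j * rho (b * p) i)"
        unfolding f D_def V_def by (simp add: algebra_simps)
      moreover have "norm (D + V - 1) \<le> M1 + M2 + 1"
        using M1(2)[of "N + int i - j"] M2(2)[of "int i - N + j"] unfolding D_def[symmetric] V_def[symmetric]
        by (intro order.trans[OF norm_triangle_ineq4] add_mono order.trans[OF norm_triangle_ineq]) auto
      ultimately show "norm (f (j, i)) \<le> (M1 + M2 + 1) * norm ((tau j * 1 powi j) * (rho (b * p) i * 1 ^ i))"
        by (simp add: norm_mult mult_right_mono)
    qed
    have in1: "((\<lambda>i. f (j, i)) has_sum (tau j * (psi_coeff b p (N - j) / \<kappa>))) UNIV" for j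
      unfolding f_def case_prod_conv by (intro has_sum_cmult_right coeff_pfrac)
    have in2: "((\<lambda>j. f (j, i)) has_sum co N i) UNIV" for i
    proof -
      have t0: "(tau has_sum 0) UNIV"
        using has_sum_theta[of 1] theta_q_power[of 0] by simp
      have "((\<lambda>j. rho (b * p) i * (tau j / (1 - b * q powi (N + int i - j))
         + tau j / (1 - p * q powi (int i - N + j)) + - tau j)) has_sum
         (rho (b * p) i * (tau (N + int i) * b powi (N + int i) * Cb
        + - (tau (int i - N + 1) * p powi (int i - N + 1) * Cp) + - 0))) UNIV"
        unfolding Cb_def Cp_def
        by (intro has_sum_cmult_right has_sum_add has_sum_uminusI tau_div_has_sum tau_div_has_sum' t0 assms)
      thus ?thesis unfolding f co_def by simp
    qed
    show ?thesis by (rule has_sum_fubini_ex[OF summ in1 in2])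
  qed
  then obtain S where S: "\<And>N. ((\<lambda>j. tau j * (psi_coeff b p (N - j) / \<kappa>)) has_sum S N) UNIV"
     "\<And>N. (co N has_sum S N) UNIV" by metis

  have k0: "\<kappa> \<noteq> 0" using bnz assms by (simp add: \<kappa>_def)
  have lhs: "((\<lambda>N. S N * y powi N) has_sum (theta y * (psi b p y / \<kappa>))) UNIV"
  proof -
    have "((\<lambda>(j, k). (tau j * y powi j) * (psi_coeff b p k * y powi k)) has_sum (theta y * psi b p y)) UNIV"
      using assms bnz pnz
      by (intro has_sum_prod tau_abs_summable psi_coeff_abs_summable has_sum_theta psi_has_sum) auto
    hence "((\<lambda>x. (\<lambda>(j, k). (tau j * y powi j) * (psi_coeff b p k * y powi k)) x * (1 / \<kappa>)) has_sum (theta y * psi b p y * (1 / \<kappa>))) UNIV"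
      by (rule has_sum_cmult_left)
    moreover have "bij (\<lambda>(N, j). (j, N - j :: int))"
      by (rule bij_betwI[of _ _ _ "\<lambda>(j, k). (j + k, j)"]) auto
    ultimately have "((\<lambda>z. (\<lambda>(j, k). (tau j * y powi j) * (psi_coeff b p k * y powi k)) ((\<lambda>(N, j). (j, N - j :: int)) z) * (1 / \<kappa>)) has_sum (theta y * psi b p y * (1 / \<kappa>))) UNIV"
      by (rule has_sum_bij)
    also have "(\<lambda>z. (\<lambda>(j, k). (tau j * y powi j) * (psi_coeff b p k * y powi k)) ((\<lambda>(N, j). (j, N - j :: int)) z) * (1 / \<kappa>))
      = (\<lambda>(N, j). tau j * (psi_coeff b p (N - j) / \<kappa>) * y powi N)"
      using assms(3) by (auto simp: fun_eq_iff power_int_diff)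
    finally have "((\<lambda>(N, j). tau j * (psi_coeff b p (N - j) / \<kappa>) * y powi N) has_sum (theta y * psi b p y * (1 / \<kappa>))) (UNIV \<times> UNIV)"
      by simp
    moreover have "((\<lambda>j. tau j * (psi_coeff b p (N - j) / \<kappa>) * y powi N) has_sum (S N * y powi N)) UNIV" for N
      by (intro has_sum_cmult_left S(1))
    ultimately show ?thesis
      using has_sum_SigmaD[where g = "\<lambda>N. S N * y powi N" and A = UNIV and B = "\<lambda>_. UNIV"] by fastforce
  qed

  have rhs: "((\<lambda>N. S N * y powi N) has_sum
      (Cb * (theta (b * y) * Phi (b * p) (1 / y)) - Cp * y * (theta (p / y) * Phi (b * p) y))) UNIV"
  proof -
    have "((\<lambda>(M, i). (tau M * (b * y) powi M) * (rho (b * p) i * (1 / y) ^ i)) has_sum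
         (theta (b * y) * Phi (b * p) (1 / y))) UNIV"
      by (intro has_sum_prod tau_abs_summable rho_abs_summable has_sum_theta Phi_has_sum)
    moreover have "bij (\<lambda>(N, i). (N + int i, i))"
      by (rule bij_betwI[of _ _ _ "\<lambda>(M, i). (M - int i, i)"]) auto
    ultimately have "((\<lambda>z. (\<lambda>(M, i). (tau M * (b * y) powi M) * (rho (b * p) i * (1 / y) ^ i)) ((\<lambda>(N, i). (N + int i, i)) z)) has_sum
         (theta (b * y) * Phi (b * p) (1 / y))) UNIV"
      by (rule has_sum_bij)
    hence 1: "((\<lambda>z. Cb * (\<lambda>(M, i). (tau M * (b * y) powi M) * (rho (b * p) i * (1 / y) ^ i)) ((\<lambda>(N, i). (N + int i, i)) z)) has_sum
         (Cb * (theta (b * y) * Phi (b * p) (1 / y)))) UNIV"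
      by (rule has_sum_cmult_right)
    have "((\<lambda>(M, i). (tau M * (p / y) powi M) * (rho (b * p) i * y ^ i)) has_sum
         (theta (p / y) * Phi (b * p) y)) UNIV"
      by (intro has_sum_prod tau_abs_summable rho_abs_summable has_sum_theta Phi_has_sum)
    moreover have "bij (\<lambda>(N, i). (int i - N + 1, i))"
      by (rule bij_betwI[of _ _ _ "\<lambda>(M, i). (int i + 1 - M, i)"]) auto
    ultimately have "((\<lambda>z. (\<lambda>(M, i). (tau M * (p / y) powi M) * (rho (b * p) i * y ^ i)) ((\<lambda>(N, i). (int i - N + 1, i)) z)) has_sum
         (theta (p / y) * Phi (b * p) y)) UNIV"
      by (rule has_sum_bij)
    hence 2: "((\<lambda>z. - (Cp * y * (\<lambda>(M, i). (tau M * (p / y) powi M) * (rho (b * p) i * y ^ i)) ((\<lambda>(N, i). (int i - N + 1, i)) z))) has_sum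
         (- (Cp * y * (theta (p / y) * Phi (b * p) y)))) UNIV"
      by (intro has_sum_uminusI has_sum_cmult_right)
    have "((\<lambda>(N, i). co N i * y powi N) has_sum (Cb * (theta (b * y) * Phi (b * p) (1 / y)) - Cp * y * (theta (p / y) * Phi (b * p) y))) (UNIV \<times> UNIV)"
    proof -
      have "Cb * ((tau (N + int i) * (b * y) powi (N + int i)) * (rho (b * p) i * (1 / y) ^ i))
         + - (Cp * y * ((tau (int i - N + 1) * (p / y) powi (int i - N + 1)) * (rho (b * p) i * y ^ i)))
         = co N i * y powi N" for N i
      proof -
        have y1: "(b * y) powi (N + int i) * (1 / y) ^ i = b powi (N + int i) * y powi N"
          using assms(3) by (simp add: power_int_mult_distrib power_int_add power_divide)
        have y2: "y * ((p / y) powi (int i - N + 1) * y ^ i) = p powi (int i - N + 1) * y powi N"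
          using assms(3) by (simp add: power_int_divide_distrib power_int_add power_int_diff)
        have z1: "Cb * ((tau (N + int i) * (b * y) powi (N + int i)) * (rho (b * p) i * (1 / y) ^ i))
          = Cb * tau (N + int i) * rho (b * p) i * (b powi (N + int i) * y powi N)"
          unfolding y1[symmetric] by simp
        have z2: "Cp * y * ((tau (int i - N + 1) * (p / y) powi (int i - N + 1)) * (rho (b * p) i * y ^ i))
          = Cp * tau (int i - N + 1) * rho (b * p) i * (p powi (int i - N + 1) * y powi N)"
          unfolding y2[symmetric] by simp
        show ?thesis unfolding z1 z2 co_def by (simp add: algebra_simps)
      qed
      thus ?thesis using has_sum_add[OF 1 2] by (simp add: case_prod_unfold)
    qed
    moreover have "((\<lambda>i. co N i * y powi N) has_sum (S N * y powi N)) UNIV" for N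
      by (intro has_sum_cmult_left S(2))
    ultimately show ?thesis
      using has_sum_SigmaD[where g = "\<lambda>N. S N * y powi N" and A = UNIV and B = "\<lambda>_. UNIV"] by fastforce
  qed
  have "theta y * (psi b p y / \<kappa>) =
      Cb * (theta (b * y) * Phi (b * p) (1 / y)) - Cp * y * (theta (p / y) * Phi (b * p) y)"
    by (rule has_sum_unique[OF lhs rhs])
  hence "theta y * psi b p y = \<kappa> * Cb * (theta (b * y) * Phi (b * p) (1 / y))
     - \<kappa> * Cp * y * (theta (p / y) * Phi (b * p) y)"
    using k0 by (simp add: field_simps)
  note eq = this
  have "theta y * psi b p y * Q (b * p) = (\<kappa> * Q (b * p) * Cb) * theta (b * y) * Phi (b * p) (1 / y)
     - (\<kappa> * Q (b * p) * Cp) * y * theta (p / y) * Phi (b * p) y"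
    unfolding eq by (simp add: algebra_simps)
  moreover have "\<kappa> * Q (b * p) * Cb = Q q / Q (q / b)"
    using bnz assms by (simp add: \<kappa>_def Cb_def jacobi_triple power3_eq_cube)
  moreover have "\<kappa> * Q (b * p) * Cp = Q b * Q q ^ 2 / theta p"
    using assms by (simp add: \<kappa>_def Cp_def power3_eq_cube power2_eq_square)
  ultimately show ?thesis by simp
qed

lemma gauss_square: "q ^ (m choose 2) * q ^ (m choose 2) * q ^ m = (q ^ m) ^ m"
proof -
  have "(m choose 2) + (m choose 2) + m = m * m"
    by (induction m) (auto simp: choose2_Suc numeral_2_eq_2)
  thus ?thesis by (metis power_add power_mult)
qed

text \<open>
  For \<open>b = q\<^bsup>-m\<^esup>\<close> the coefficients vanish beyond \<open>k = m\<close>.  Read downwards from \<open>k = m\<close>, the series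
  is \<open>Phi\<close> at \<open>1 / y\<close> up to a factor, which the theta quotient accounts for.
\<close>

lemma psi_degenerate:
  assumes "p \<noteq> 0" "y \<noteq> 0" "theta p \<noteq> 0" "Q (b * p) \<noteq> 0" "b * q ^ m = 1"
  shows "theta y * psi b p y * Q (b * p) = Q q / Q (q / b) * theta (b * y) * Phi (b * p) (1 / y)"
proof -
  have b: "b = 1 / q ^ m" using assms(5) by (simp add: field_simps)
  have b0: "b \<noteq> 0" by (simp add: b)
  have bpow: "b * q powi (int m - int i) = 1 / q ^ i" for i
    by (simp add: b power_int_diff)
  have down: "qpoch b q (int m - int i) = poch b m * (eps i * q ^ i)" for i
  proof (induction i)
    case 0 thus ?case by (simp add: qpoch_nat)
  next
    case (Suc i)
    define A where "A = qpoch b q (int m - int (Suc i))"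
    have nz: "1 - q ^ Suc i \<noteq> 0"
      using one_minus_shift_nonzero[OF Q_q_nonzero, of i] by simp
    have ne: "b * q powi (int m - int (Suc i)) \<noteq> 1"
      unfolding bpow using nz by auto
    have "qpoch b q (int m - int (Suc i) + 1) = A * (1 - 1 / q ^ Suc i)"
      unfolding A_def bpow[symmetric] by (rule qpoch_succ[OF b0 ne])
    hence "A * (1 - 1 / q ^ Suc i) = poch b m * (eps i * q ^ i)"
      using Suc by simp
    hence "A * (1 - q ^ Suc i) = - (poch b m * (eps i * q ^ i)) * q ^ Suc i"
      by (simp add: field_simps)
    also have "\<dots> = poch b m * (- (q ^ i) * eps i) * q ^ Suc i" by simp
    also have "\<dots> = poch b m * (eps (Suc i) * q ^ Suc i) * (1 - q ^ Suc i)"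
      unfolding eps_Suc[symmetric] by (simp only: mult_ac)
    finally show ?case using nz unfolding A_def by (simp only: mult_right_cancel not_False_eq_True)
  qed
  have coeff_down: "psi_coeff b p (int m - int i) = poch b m * rho (b * p) i / Q (b * p)" for i
  proof -
    have e: "p * q powi (- (int m - int i)) = b * p * q ^ i"
      by (simp add: b power_int_diff)
    have "Q (b * p) = Q (b * p * q ^ i) * poch (b * p) i" by (rule Q_split)
    thus ?thesis
      unfolding psi_coeff_def down rho_def e using assms(4) by (simp add: field_simps)
  qed
  have "((\<lambda>i. poch b m / Q (b * p) * y ^ m * (rho (b * p) i * (1 / y) ^ i)) has_sum
      (poch b m / Q (b * p) * y ^ m * Phi (b * p) (1 / y))) UNIV"
    by (intro has_sum_cmult_right Phi_has_sum)
  also have "(\<lambda>i. poch b m / Q (b * p) * y ^ m * (rho (b * p) i * (1 / y) ^ i)) =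
      (\<lambda>i. psi_coeff b p (int m - int i) * y powi (int m - int i))"
    unfolding coeff_down using assms(2) by (auto simp: power_int_diff power_divide)
  also have "(\<dots> has_sum (poch b m / Q (b * p) * y ^ m * Phi (b * p) (1 / y))) UNIV \<longleftrightarrow>
     ((\<lambda>k. psi_coeff b p k * y powi k) has_sum (poch b m / Q (b * p) * y ^ m * Phi (b * p) (1 / y))) (range (\<lambda>i. int m - int i))"
    by (subst has_sum_reindex) (auto simp: o_def inj_on_def)
  also have "\<dots> \<longleftrightarrow> ((\<lambda>k. psi_coeff b p k * y powi k) has_sum (poch b m / Q (b * p) * y ^ m * Phi (b * p) (1 / y))) UNIV"
  proof (rule has_sum_cong_neutral)
    fix k assume k: "k \<in> UNIV - range (\<lambda>i. int m - int i)"
    have "k > int m"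
    proof (rule ccontr)
      assume "\<not> k > int m"
      hence "k = int m - int (nat (int m - k))" by simp
      thus False using k by blast
    qed
    then obtain n where n: "k = int n" "m < n"
      by (metis nonneg_int_cases of_nat_0_le_iff of_nat_less_iff order.strict_trans1 less_imp_le)
    have "poch b n = 0"
      unfolding poch_def using n(2) assms(5) by (auto simp: prod_zero_iff)
    thus "psi_coeff b p k * y powi k = 0" by (simp add: psi_coeff_def n qpoch_nat)
  qed auto
  finally have psi: "psi b p y = poch b m / Q (b * p) * y ^ m * Phi (b * p) (1 / y)"
    unfolding psi_def by (rule infsumI)
  have "poch b m = (\<Prod>k<m. 1 - 1 * q powi (- int m) * q ^ k)"
    unfolding poch_def by (simp add: b power_int_minus divide_inverse)
  also have "\<dots> = (- 1 / q) ^ m / q ^ (m choose 2) * poch q m"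
    using shifted_prod[of 1 m] by simp
  also have "(- 1 / q) ^ m = (- 1) ^ m / q ^ m" by (simp only: power_divide)
  also have "(- 1) ^ m / q ^ m / q ^ (m choose 2) * poch q m = tau (int m) * b ^ m * poch q m"
    using gauss_square[of m] by (simp add: tau_nat b power_divide divide_simps) (simp add: mult_ac)
  finally have pb: "poch b m = tau (int m) * b ^ m * poch q m" .
  have e: "b * y * q powi int m = y" using assms(5) by (simp add: mult_ac)
  hence th: "theta (b * y) = tau (int m) * (b * y) ^ m * theta y"
    using theta_shift[of "b * y" "int m", unfolded e] b0 assms(2) by simp
  have "Q (q / b) = Q (q * q ^ m)" by (simp add: b)
  hence "Q q / Q (q / b) = poch q m"
    using Q_split[of q m] Q_nonzero_shift[OF Q_q_nonzero, of m] by simp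
  thus ?thesis
    unfolding psi pb th using assms(4) by (simp add: power_mult_distrib)
qed

text \<open>
  The factor \<open>Q b\<close> of the second term vanishes in the degenerate case \<open>b = q\<^bsup>-m\<^esup>\<close>, which makes the
  formula uniform in \<open>b\<close>.
\<close>

lemma psi_formula:
  assumes "b \<noteq> 0" "p \<noteq> 0" "y \<noteq> 0" "Q (q / b) \<noteq> 0" "theta p \<noteq> 0" "Q (b * p) \<noteq> 0"
  shows "theta y * psi b p y * Q (b * p) =
    Q q / Q (q / b) * theta (b * y) * Phi (b * p) (1 / y)
    - Q b * Q q ^ 2 / theta p * y * theta (p / y) * Phi (b * p) y"
proof (cases "Q b = 0")
  case True
  then obtain m where "b * q ^ m = 1" using Q_eq_0_iff by blast
  thus ?thesis using psi_degenerate[of p y b m] assms True by simp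
next
  case False
  thus ?thesis using psi_generic assms theta_nonzero_iff[of b] by blast
qed

text \<open>
  The theta quotients in \<open>psi_formula\<close> change under \<open>y \<mapsto> y q\<^sup>j\<close> only by the factors \<open>b\<^bsup>-j\<^esup>\<close> and \<open>p\<^sup>j\<close>.
\<close>

lemma psi_shift:
  assumes "b \<noteq> 0" "p \<noteq> 0" "x \<noteq> 0" "Q (q / b) \<noteq> 0" "theta p \<noteq> 0" "Q (b * p) \<noteq> 0" "theta x \<noteq> 0"
  shows "psi b p (x * q powi j) =
     Q q / Q (q / b) * theta (b * x) / theta x / Q (b * p) * (b powi (- j) * Phi (b * p) (1 / (x * q powi j)))
   - Q b * Q q ^ 2 / theta p * x * theta (p / x) / theta x / Q (b * p) * (p powi j * Phi (b * p) (x * q powi j))"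
proof -
  define y where "y = x * q powi j"
  have y0: "y \<noteq> 0" using assms by (simp add: y_def)
  have ty: "theta y \<noteq> 0" unfolding y_def by (rule theta_powi_nonzero) (use assms in auto)
  have e1: "theta x = tau j * x powi j * theta y"
    unfolding y_def by (rule theta_shift) (use assms in auto)
  have e2: "theta (b * x) = tau j * (b * x) powi j * theta (b * y)"
    unfolding y_def mult.assoc[symmetric] by (rule theta_shift) (use assms in auto)
  have e3: "theta (p / x) = tau (- j) * (p / x) powi (- j) * theta (p / y)"
  proof -
    have "p / x * q powi (- j) = p / y" by (simp add: y_def power_int_minus field_simps)
    thus ?thesis using theta_shift[of "p / x" "- j"] assms by simp
  qed
  have r1: "theta (b * x) / theta x * b powi (- j) = theta (b * y) / theta y"
    unfolding e1 e2 using assms by (simp add: power_int_mult_distrib power_int_minus)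
  have r2: "x * theta (p / x) / theta x * p powi j = y * theta (p / y) / theta y"
    unfolding e1 e3 tau_uminus using assms
    by (simp add: power_int_divide_distrib power_int_minus y_def field_simps)
  have "psi b p y = (Q q / Q (q / b) * theta (b * y) * Phi (b * p) (1 / y)
    - Q b * Q q ^ 2 / theta p * y * theta (p / y) * Phi (b * p) y) / (theta y * Q (b * p))"
    unfolding psi_formula[OF assms(1,2) y0 assms(4-6), symmetric] using ty assms(6) by simp
  also have "\<dots> = Q q / Q (q / b) / Q (b * p) * (theta (b * y) / theta y) * Phi (b * p) (1 / y)
    - Q b * Q q ^ 2 / theta p / Q (b * p) * (y * theta (p / y) / theta y) * Phi (b * p) y"
    by (simp add: diff_divide_distrib mult_ac)
  also have "\<dots> = Q q / Q (q / b) / Q (b * p) * (theta (b * x) / theta x * b powi (- j)) * Phi (b * p) (1 / y)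
    - Q b * Q q ^ 2 / theta p / Q (b * p) * (x * theta (p / x) / theta x * p powi j) * Phi (b * p) y"
    unfolding r1 r2 ..
  finally show ?thesis unfolding y_def[symmetric] by (simp add: mult_ac)
qed

section \<open>Reintroducing the two infinite products\<close>

lemma triple_abs_summable:
  assumes "X \<ge> 0" "X * norm t < r" "\<And>i. norm (g i) \<le> M * (gauss_power r i * X ^ i)" "M > 0"
  shows "(\<lambda>(i, m, n). g i * ((eps m * (t / q ^ i) ^ m) * (eps n * (s * q ^ i) ^ n))) abs_summable_on UNIV"
proof -
  obtain E where E: "E > 0" "\<And>n. norm (eps n) \<le> E * gauss_power r n" using eps_bound by blast
  have "(\<lambda>x. M * E * E * (\<lambda>(i, m, n). gauss_power r i * X ^ i * (gauss_power r m * (norm t / r ^ i) ^ m)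
            * (gauss_power r n * norm s ^ n)) x) summable_on UNIV"
    by (intro summable_on_cmult_right summable_on_gauss_triple) (use assms in auto)
  thus ?thesis
  proof (rule Infinite_Sum.abs_summable_on_comparison_test', safe)
    fix i m n
    have g: "gauss_power r k \<ge> 0" for k using gauss_power_pos[of r k] by (simp add: less_imp_le)
    have "norm (s * q ^ i) \<le> norm s * 1"
      unfolding norm_mult norm_power by (intro mult_left_mono power_le_one) auto
    hence "norm (s * q ^ i) ^ n \<le> norm s ^ n" by (intro power_mono) auto
    hence "norm (eps n * (s * q ^ i) ^ n) \<le> E * gauss_power r n * norm s ^ n"
      unfolding norm_mult[of "eps n"] norm_power using E g by (intro mult_mono) auto
    moreover have "norm (eps m * (t / q ^ i) ^ m) \<le> E * gauss_power r m * (norm t / r ^ i) ^ m"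
      unfolding norm_mult[of "eps m"] norm_power norm_divide using E g by (intro mult_mono) auto
    ultimately have "norm (g i * ((eps m * (t / q ^ i) ^ m) * (eps n * (s * q ^ i) ^ n))) \<le>
       M * (gauss_power r i * X ^ i) * ((E * gauss_power r m * (norm t / r ^ i) ^ m) * (E * gauss_power r n * norm s ^ n))"
      unfolding norm_mult[of "g i"] norm_mult[of "eps m * _"] using assms E g
      by (intro mult_mono mult_nonneg_nonneg) auto
    thus "norm (g i * ((eps m * (t / q ^ i) ^ m) * (eps n * (s * q ^ i) ^ n))) \<le>
       M * E * E * (gauss_power r i * X ^ i * (gauss_power r m * (norm t / r ^ i) ^ m) * (gauss_power r n * norm s ^ n))"
      by (simp add: mult_ac)
  qed
qed

lemma triple_abs_summable':
  assumes "X \<ge> 0" "X * norm t < r" "\<And>i. norm (g i) \<le> M * (gauss_power r i * X ^ i)" "M > 0"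
  shows "(\<lambda>(i, m, n). g i * ((eps m * (s * q ^ i) ^ m) * (eps n * (t / q ^ i) ^ n))) abs_summable_on UNIV"
proof -
  have b: "bij (\<lambda>(i :: nat, m :: nat, n :: nat). (i, n, m))"
    by (rule bij_betwI[of _ _ _ "\<lambda>(i, m, n). (i, n, m)"]) auto
  from triple_abs_summable[OF assms, of s]
  have "(\<lambda>z. norm ((\<lambda>(i, m, n). g i * ((eps m * (t / q ^ i) ^ m) * (eps n * (s * q ^ i) ^ n))) ((\<lambda>(i, m, n). (i, n, m)) z))) summable_on UNIV"
    by (rule iffD2[OF summable_on_reindex_bij_betw[OF b]])
  thus ?thesis by (simp add: case_prod_unfold mult_ac)
qed

lemma euler_prod:
  "((\<lambda>(m, n). g * ((eps m * w ^ m) * (eps n * v ^ n))) has_sum (g * (Q w * Q v))) UNIV"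
  using has_sum_cmult_right[OF has_sum_prod[OF euler_abs_summable euler_abs_summable euler euler], of g w v]
  by (simp add: case_prod_unfold)

lemma rho_bound:
  obtains M where "M > 0" "\<And>i. norm (rho \<beta> i * w ^ i) \<le> M * (gauss_power r i * (r * norm w) ^ i)"
proof -
  obtain M where M: "M > 0" "\<And>n. norm (poch \<beta> n) \<le> M" using poch_bounded by blast
  obtain E where E: "E > 0" "\<And>n. norm (eps n) \<le> E * gauss_power r n" using eps_bound by blast
  have "norm (rho \<beta> i * w ^ i) \<le> M * E * (gauss_power r i * (r * norm w) ^ i)" for i
  proof -
    have "norm (rho \<beta> i * w ^ i) = norm (poch \<beta> i) * norm (eps i) * (r * norm w) ^ i"
      by (simp add: rho_def norm_mult norm_power power_mult_distrib)
    also have "\<dots> \<le> M * (E * gauss_power r i) * (r * norm w) ^ i"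
      using M E by (intro mult_mono) (auto simp: less_imp_le gauss_power_pos)
    finally show ?thesis by (simp add: mult_ac)
  qed
  thus ?thesis using that[of "M * E"] M E by simp
qed

text \<open>
  Expand \<open>Q (c q\<^sup>k)\<close> and \<open>Q (v q\<^bsup>-k\<^esup>)\<close> by Euler's series in \<open>m\<close> and \<open>n\<close>, and sum over \<open>k\<close> first.  This
  produces \<open>psi\<close> at \<open>x q\<^bsup>m-n\<^esup>\<close>, to which \<open>psi_shift\<close> applies.  Then expand \<open>Phi\<close> in powers with index
  \<open>i\<close>; for fixed \<open>i\<close>, the sums over \<open>m\<close> and \<open>n\<close> are Euler series once more.  The two hypotheses in
  \<open>small\<close> are the majorant condition \<open>X t < r\<close> in the cases that occur.
\<close>

lemma psi_product_sum:
  assumes "b \<noteq> 0" "p \<noteq> 0" "x \<noteq> 0" "Q (q / b) \<noteq> 0" "theta p \<noteq> 0" "Q (b * p) \<noteq> 0" "theta x \<noteq> 0"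
    and small: "norm (x * v / p) < 1" "norm (c / (b * x)) < 1"
  shows "\<exists>S1 S2.
    ((\<lambda>i. rho (b * p) i * (1 / x) ^ i * (Q (c / b / q ^ i) * Q (b * v * q ^ i))) has_sum S1) UNIV \<and>
    ((\<lambda>i. rho (b * p) i * x ^ i * (Q (c * p * q ^ i) * Q (v / p / q ^ i))) has_sum S2) UNIV \<and>
    ((\<lambda>k. psi_coeff b p k * x powi k * (Q (c * q powi k) * Q (v * q powi (- k)))) has_sum
      (Q q / Q (q / b) * theta (b * x) / theta x / Q (b * p) * S1
       - Q b * Q q ^ 2 / theta p * x * theta (p / x) / theta x / Q (b * p) * S2)) UNIV"
proof -
  define \<alpha> \<beta> where "\<alpha> = Q q / Q (q / b) * theta (b * x) / theta x / Q (b * p)"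
    and "\<beta> = Q b * Q q ^ 2 / theta p * x * theta (p / x) / theta x / Q (b * p)"
  have pnz: "Q p \<noteq> 0" "Q (q / p) \<noteq> 0" using theta_nonzero_iff assms by auto
  define w where "w = (\<lambda>(m, n). (eps m * c ^ m) * (eps n * v ^ n))"

  have "\<exists>S1. ((\<lambda>i. rho (b * p) i * (1 / x) ^ i * (Q (c / b / q ^ i) * Q (b * v * q ^ i))) has_sum S1) UNIV \<and>
    ((\<lambda>(m, n). w (m, n) * (b powi (int n - int m) * Phi (b * p) (1 / (x * q powi (int m - int n))))) has_sum S1) UNIV"
  proof -
    obtain M where M: "M > 0" "\<And>i. norm (rho (b * p) i * (1 / x) ^ i) \<le> M * (gauss_power r i * (r * norm (1 / x)) ^ i)"
      using rho_bound by blast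
    have sm: "r * norm (1 / x) * norm (c / b) < r"
      using mult_strict_left_mono[OF small(2), of r] by (simp add: norm_divide norm_mult mult_ac)
    show ?thesis
    proof (rule has_sum_fubini_ex[OF triple_abs_summable[OF _ sm M(2,1), of "b * v"]], goal_cases)
      case (2 i)
      show ?case using euler_prod[of "rho (b * p) i * (1 / x) ^ i" "c / b / q ^ i" "b * v * q ^ i"]
        by (simp add: case_prod_unfold)
    next
      case (3 mn)
      obtain m n where mn: "mn = (m, n)" by (cases mn)
      have "((\<lambda>i. w (m, n) * b powi (int n - int m) * (rho (b * p) i * (1 / (x * q powi (int m - int n))) ^ i)) has_sum
         (w (m, n) * b powi (int n - int m) * Phi (b * p) (1 / (x * q powi (int m - int n))))) UNIV"
        by (intro has_sum_cmult_right Phi_has_sum)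
      also have "(\<lambda>i. w (m, n) * b powi (int n - int m) * (rho (b * p) i * (1 / (x * q powi (int m - int n))) ^ i)) =
        (\<lambda>i. rho (b * p) i * (1 / x) ^ i * ((eps m * (c / b / q ^ i) ^ m) * (eps n * (b * v * q ^ i) ^ n)))"
        using assms by (simp add: fun_eq_iff w_def power_int_diff power_divide power_mult_distrib field_simps flip: power_mult)
      finally show ?case by (simp add: mn mult_ac)
    qed auto
  qed
  then obtain S1 where S1: "((\<lambda>i. rho (b * p) i * (1 / x) ^ i * (Q (c / b / q ^ i) * Q (b * v * q ^ i))) has_sum S1) UNIV"
    "((\<lambda>(m, n). w (m, n) * (b powi (int n - int m) * Phi (b * p) (1 / (x * q powi (int m - int n))))) has_sum S1) UNIV"
    by blast

  have "\<exists>S2. ((\<lambda>i. rho (b * p) i * x ^ i * (Q (c * p * q ^ i) * Q (v / p / q ^ i))) has_sum S2) UNIV \<and>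
    ((\<lambda>(m, n). w (m, n) * (p powi (int m - int n) * Phi (b * p) (x * q powi (int m - int n)))) has_sum S2) UNIV"
  proof -
    obtain M where M: "M > 0" "\<And>i. norm (rho (b * p) i * x ^ i) \<le> M * (gauss_power r i * (r * norm x) ^ i)"
      using rho_bound by blast
    have sm: "r * norm x * norm (v / p) < r"
      using mult_strict_left_mono[OF small(1), of r] by (simp add: norm_divide norm_mult mult_ac)
    show ?thesis
    proof (rule has_sum_fubini_ex[OF triple_abs_summable'[OF _ sm M(2,1), of "c * p"]], goal_cases)
      case (2 i)
      show ?case using euler_prod[of "rho (b * p) i * x ^ i" "c * p * q ^ i" "v / p / q ^ i"]
        by (simp add: case_prod_unfold)
    next
      case (3 mn)
      obtain m n where mn: "mn = (m, n)" by (cases mn)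
      have "((\<lambda>i. w (m, n) * p powi (int m - int n) * (rho (b * p) i * (x * q powi (int m - int n)) ^ i)) has_sum
         (w (m, n) * p powi (int m - int n) * Phi (b * p) (x * q powi (int m - int n)))) UNIV"
        by (intro has_sum_cmult_right Phi_has_sum)
      also have "(\<lambda>i. w (m, n) * p powi (int m - int n) * (rho (b * p) i * (x * q powi (int m - int n)) ^ i)) =
        (\<lambda>i. rho (b * p) i * x ^ i * ((eps m * (c * p * q ^ i) ^ m) * (eps n * (v / p / q ^ i) ^ n)))"
        using assms by (simp add: fun_eq_iff w_def power_int_diff power_divide power_mult_distrib field_simps flip: power_mult)
      finally show ?case by (simp add: mn mult_ac)
    qed auto
  qed
  then obtain S2 where S2: "((\<lambda>i. rho (b * p) i * x ^ i * (Q (c * p * q ^ i) * Q (v / p / q ^ i))) has_sum S2) UNIV"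
    "((\<lambda>(m, n). w (m, n) * (p powi (int m - int n) * Phi (b * p) (x * q powi (int m - int n)))) has_sum S2) UNIV"
    by blast

  define f where "f = (\<lambda>(k, m, n). psi_coeff b p k * x powi k * ((eps m * (c * q powi k) ^ m) * (eps n * (v * q powi (- k)) ^ n)))"
  have summ: "f abs_summable_on UNIV"
  proof (rule abs_summable_on_int_prod)
    obtain M where M: "M > 0" "\<And>i. norm (psi_coeff b p (int i)) \<le> M * (gauss_power r i * (r / norm p) ^ i)"
      using psi_coeff_bound_pos[of p b] assms pnz by blast
    have b: "norm (psi_coeff b p (int i) * x ^ i) \<le> M * (gauss_power r i * (r / norm p * norm x) ^ i)" for i
      using mult_right_mono[OF M(2)[of i], of "norm x ^ i"]
      by (simp add: norm_mult norm_power power_mult_distrib power_divide mult_ac)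
    have sm: "r / norm p * norm x * norm v < r"
      using mult_strict_left_mono[OF small(1), of r] by (simp add: norm_divide norm_mult mult_ac)
    show "(\<lambda>(n, z). f (int n, z)) abs_summable_on UNIV"
      using triple_abs_summable'[OF _ sm b M(1), of c]
      by (simp add: f_def case_prod_unfold power_int_minus divide_inverse)
  next
    obtain M where M: "M > 0" "\<And>i. norm (psi_coeff b p (- int i)) \<le> M * (gauss_power r i * (r / norm b) ^ i)"
      using psi_coeff_bound_neg[of b p] assms pnz by blast
    have b: "norm (psi_coeff b p (- int i) * x powi (- int i)) \<le> M * (gauss_power r i * (r / norm b / norm x) ^ i)" for i
      using mult_right_mono[OF M(2)[of i], of "(1 / norm x) ^ i"] unfolding powi_neg
      by (simp add: norm_mult norm_divide norm_power power_mult_distrib power_divide mult_ac)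
    have sm: "r / norm b / norm x * norm c < r"
      using mult_strict_left_mono[OF small(2), of r] by (simp add: norm_divide norm_mult mult_ac)
    show "(\<lambda>(n, z). f (- int n, z)) abs_summable_on UNIV"
      using triple_abs_summable[OF _ sm b M(1), of v]
      by (simp add: f_def case_prod_unfold power_int_minus divide_inverse)
  qed
  have in1: "((\<lambda>mn. f (k, mn)) has_sum (psi_coeff b p k * x powi k * (Q (c * q powi k) * Q (v * q powi (- k))))) UNIV" for k
    using euler_prod[of "psi_coeff b p k * x powi k" "c * q powi k" "v * q powi (- k)"]
    by (simp add: f_def case_prod_unfold)
  have in2: "((\<lambda>k. f (k, mn)) has_sum
     (\<alpha> * (\<lambda>(m, n). w (m, n) * (b powi (int n - int m) * Phi (b * p) (1 / (x * q powi (int m - int n))))) mn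
    - \<beta> * (\<lambda>(m, n). w (m, n) * (p powi (int m - int n) * Phi (b * p) (x * q powi (int m - int n)))) mn)) UNIV" for mn
  proof -
    obtain m n where mn: "mn = (m, n)" by (cases mn)
    have "((\<lambda>k. w (m, n) * (psi_coeff b p k * (x * q powi (int m - int n)) powi k)) has_sum (w (m, n) * psi b p (x * q powi (int m - int n)))) UNIV"
      using assms by (intro has_sum_cmult_right psi_has_sum) auto
    also have "(\<lambda>k. w (m, n) * (psi_coeff b p k * (x * q powi (int m - int n)) powi k)) = (\<lambda>k. f (k, mn))"
    proof
      fix k
      have "(q powi (int m - int n)) powi k = (q powi k) ^ m * (q powi (- k)) ^ n"
        using q_nz by (simp add: algebra_simps flip: power_int_mult power_int_add power_int_of_nat)
      thus "w (m, n) * (psi_coeff b p k * (x * q powi (int m - int n)) powi k) = f (k, mn)"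
        by (simp add: f_def w_def mn power_int_mult_distrib power_mult_distrib)
    qed
    finally show ?thesis
      unfolding psi_shift[OF assms(1-7)] \<alpha>_def[symmetric] \<beta>_def[symmetric] mn case_prod_conv
      by (simp add: algebra_simps)
  qed
  have "((\<lambda>k. psi_coeff b p k * x powi k * (Q (c * q powi k) * Q (v * q powi (- k)))) has_sum (\<alpha> * S1 - \<beta> * S2)) UNIV"
  proof (rule has_sum_fubini[OF summ in1 in2])
    show "((\<lambda>mn. \<alpha> * (\<lambda>(m, n). w (m, n) * (b powi (int n - int m) * Phi (b * p) (1 / (x * q powi (int m - int n))))) mn
    - \<beta> * (\<lambda>(m, n). w (m, n) * (p powi (int m - int n) * Phi (b * p) (x * q powi (int m - int n)))) mn) has_sum (\<alpha> * S1 - \<beta> * S2)) UNIV"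
      using has_sum_add[OF has_sum_cmult_right[OF S1(2), of \<alpha>] has_sum_uminusI[OF has_sum_cmult_right[OF S2(2), of \<beta>]]]
      by simp
  qed
  with S1(1) S2(1) show ?thesis unfolding \<alpha>_def \<beta>_def by blast
qed

section \<open>The two unilateral series\<close>

text \<open>
  The growth of \<open>Q (\<gamma> / q\<^sup>i)\<close> exactly consumes the Gaussian factor of \<open>eps i\<close>, leaving coefficients of
  q-binomial type.
\<close>

lemma eps_Q_shift:
  "eps i * q ^ i * X ^ i * Q (\<gamma> / q ^ i) = Q \<gamma> * ((\<Prod>j<i. X * \<gamma> - X * q * q ^ j) / poch q i)"
proof (induction i)
  case (Suc i)
  define P where "P = (\<Prod>j<i. X * \<gamma> - X * q * q ^ j)"
  have nz: "1 - q * q ^ i \<noteq> 0" using one_minus_shift_nonzero[OF Q_q_nonzero, of i] .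
  have "Q (\<gamma> / q ^ Suc i) = (1 - \<gamma> / q ^ Suc i) * Q (\<gamma> / q ^ i)"
    using Q_step[of "\<gamma> / q ^ Suc i"] by simp
  hence "eps (Suc i) * q ^ Suc i * X ^ Suc i * Q (\<gamma> / q ^ Suc i) * (1 - q * q ^ i)
     = (eps (Suc i) * (1 - q ^ Suc i)) * q ^ Suc i * X ^ Suc i * ((1 - \<gamma> / q ^ Suc i) * Q (\<gamma> / q ^ i))"
    by simp
  also have "\<dots> = (eps i * q ^ i * X ^ i * Q (\<gamma> / q ^ i)) * (X * \<gamma> - X * q * q ^ i)"
    unfolding eps_Suc by (simp add: field_simps)
  also have "\<dots> = Q \<gamma> * (P * (X * \<gamma> - X * q * q ^ i) / poch q i)"
    unfolding Suc P_def by simp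
  finally have "eps (Suc i) * q ^ Suc i * X ^ Suc i * Q (\<gamma> / q ^ Suc i)
      = Q \<gamma> * (P * (X * \<gamma> - X * q * q ^ i) / poch q i) / (1 - q * q ^ i)"
    by (rule eq_divide_imp[OF nz])
  also have "\<dots> = Q \<gamma> * (P * (X * \<gamma> - X * q * q ^ i) / (poch q i * (1 - q * q ^ i)))"
    by simp
  finally show ?case unfolding P_def poch_Suc prod.lessThan_Suc .
qed simp

lemma eps_nonzero [simp]: "eps n \<noteq> 0"
  using poch_nonzero[OF Q_q_nonzero, of n] by (simp add: eps_def)

text \<open>
  A Heine transformation: the quotient \<open>Q (\<beta> \<delta> q\<^sup>i) / Q (\<beta> q\<^sup>i)\<close> is expanded by the q-binomial theorem
  in \<open>m\<close>, and the sum over \<open>i\<close> is then a q-binomial series too.  Writing it with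
  \<open>Q (\<gamma> / q\<^sup>i)\<close> rather than with powers of \<open>\<gamma>\<close> times a shifted factorial in \<open>1 / \<gamma>\<close> includes \<open>\<gamma> = 0\<close>.
\<close>

lemma heine_sum:
  assumes "norm (X * \<gamma>) < 1" "norm \<beta> < 1"
    and S: "((\<lambda>i. rho \<beta> i * X ^ i * (Q (\<gamma> / q ^ i) * Q (\<beta> * \<delta> * q ^ i))) has_sum S) UNIV"
    and nz: "Q (X * q) \<noteq> 0"
  shows "S = Q \<gamma> * Q \<beta> * Q (X * q) / Q (X * \<gamma>) * phi21 (X * \<gamma>) \<delta> (X * q) q \<beta>"
proof -
  define P where "P = (\<lambda>i. (\<Prod>j<i. X * \<gamma> - X * q * q ^ j) / poch q i)"
  define R where "R = (\<lambda>m. (\<Prod>j<m. \<beta> - \<beta> * \<delta> * q ^ j) / poch q m)"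
  define f where "f = (\<lambda>(i, m). P i * R m * q ^ (i * m))"
  have small: "norm (w * q ^ i) < 1" if "norm w < 1" for w i
  proof -
    have "norm (w * q ^ i) \<le> norm w * 1"
      unfolding norm_mult norm_power by (intro mult_left_mono power_le_one) auto
    thus ?thesis using that by simp
  qed
  have b: "Q \<beta> \<noteq> 0" by (rule Q_nonzero_small[OF assms(2)])
  have xg: "Q (X * \<gamma>) \<noteq> 0" by (rule Q_nonzero_small[OF assms(1)])
  have Rm: "R m = \<beta> ^ m * poch \<delta> m / poch q m" for m
  proof -
    have "(\<Prod>j<m. \<beta> - \<beta> * \<delta> * q ^ j) = \<beta> ^ m * poch \<delta> m"
      by (induction m) (simp_all add: poch_Suc algebra_simps)
    thus ?thesis by (simp add: R_def)
  qed
  have Ps: "P abs_summable_on UNIV" and Rs: "R abs_summable_on UNIV"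
    unfolding P_def R_def
    by (rule summable_nonneg_imp_summable_on[OF qbinomial_summable]; use assms in simp)+
  have summ: "f abs_summable_on UNIV"
  proof (rule Infinite_Sum.abs_summable_on_comparison_test'[OF abs_summable_on_prod[OF Ps Rs]], safe)
    fix i m
    have "norm (f (i, m)) = norm (P i * R m) * norm q ^ (i * m)"
      by (simp add: f_def norm_mult norm_power)
    also have "\<dots> \<le> norm (P i * R m) * 1"
      by (intro mult_left_mono power_le_one) auto
    finally show "norm (f (i, m)) \<le> norm (P i * R m)" by simp
  qed
  have in1: "((\<lambda>m. f (i, m)) has_sum (P i * (Q (\<beta> * \<delta> * q ^ i) / Q (\<beta> * q ^ i)))) UNIV" for i
  proof -
    have "((\<lambda>m. P i * ((\<Prod>j<m. \<beta> * q ^ i - \<beta> * \<delta> * q ^ i * q ^ j) / poch q m)) has_sum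
       (P i * (Q (\<beta> * \<delta> * q ^ i) / Q (\<beta> * q ^ i)))) UNIV"
      by (intro has_sum_cmult_right qbinomial small assms)
    moreover have "(\<Prod>j<m. \<beta> * q ^ i - \<beta> * \<delta> * q ^ i * q ^ j) = (\<Prod>j<m. \<beta> - \<beta> * \<delta> * q ^ j) * q ^ (i * m)" for m
      by (induction m) (simp_all add: algebra_simps power_add)
    ultimately show ?thesis by (simp add: f_def R_def mult.assoc)
  qed
  have in2: "((\<lambda>i. f (i, m)) has_sum (R m * (Q (X * q * q ^ m) / Q (X * \<gamma> * q ^ m)))) UNIV" for m
  proof -
    have "((\<lambda>i. R m * ((\<Prod>j<i. X * \<gamma> * q ^ m - X * q * q ^ m * q ^ j) / poch q i)) has_sum
       (R m * (Q (X * q * q ^ m) / Q (X * \<gamma> * q ^ m)))) UNIV"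
      by (intro has_sum_cmult_right qbinomial small assms)
    moreover have "(\<Prod>j<i. X * \<gamma> * q ^ m - X * q * q ^ m * q ^ j) = (\<Prod>j<i. X * \<gamma> - X * q * q ^ j) * q ^ (i * m)" for i
      by (induction i) (simp_all add: algebra_simps power_add)
    ultimately show ?thesis by (simp add: f_def P_def mult_ac)
  qed
  obtain S' where S': "((\<lambda>i. P i * (Q (\<beta> * \<delta> * q ^ i) / Q (\<beta> * q ^ i))) has_sum S') UNIV"
     "((\<lambda>m. R m * (Q (X * q * q ^ m) / Q (X * \<gamma> * q ^ m))) has_sum S') UNIV"
    using has_sum_fubini_ex[OF summ in1 in2] by blast
  have "((\<lambda>i. Q \<gamma> * Q \<beta> * (P i * (Q (\<beta> * \<delta> * q ^ i) / Q (\<beta> * q ^ i)))) has_sum (Q \<gamma> * Q \<beta> * S')) UNIV"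
    by (intro has_sum_cmult_right S')
  moreover have "Q \<gamma> * Q \<beta> * (P i * (Q (\<beta> * \<delta> * q ^ i) / Q (\<beta> * q ^ i)))
      = rho \<beta> i * X ^ i * (Q (\<gamma> / q ^ i) * Q (\<beta> * \<delta> * q ^ i))" for i
  proof -
    have "rho \<beta> i * X ^ i * (Q (\<gamma> / q ^ i) * Q (\<beta> * \<delta> * q ^ i))
      = poch \<beta> i * (eps i * q ^ i * X ^ i * Q (\<gamma> / q ^ i)) * Q (\<beta> * \<delta> * q ^ i)"
      by (simp add: rho_def)
    also have "\<dots> = poch \<beta> i * (Q \<gamma> * P i) * Q (\<beta> * \<delta> * q ^ i)"
      unfolding eps_Q_shift P_def ..
    also have "poch \<beta> i = Q \<beta> / Q (\<beta> * q ^ i)"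
      using Q_split[of \<beta> i] Q_nonzero_shift[OF b, of i] by simp
    finally show ?thesis by simp
  qed
  ultimately have "S = Q \<gamma> * Q \<beta> * S'" using has_sum_unique[OF S] by simp
  moreover have "(\<lambda>m. Q (X * q) / Q (X * \<gamma>) * (qpochs [X * \<gamma>, \<delta>] q (int m) / qpochs [q, X * q] q (int m) * \<beta> ^ m)) sums S'"
  proof -
    have "R m * (Q (X * q * q ^ m) / Q (X * \<gamma> * q ^ m)) =
      Q (X * q) / Q (X * \<gamma>) * (qpochs [X * \<gamma>, \<delta>] q (int m) / qpochs [q, X * q] q (int m) * \<beta> ^ m)" for m
    proof -
      have 1: "Q (X * q * q ^ m) = Q (X * q) / poch (X * q) m"
        using Q_split[of "X * q" m] poch_nonzero[OF nz, of m] by simp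
      have 2: "1 / Q (X * \<gamma> * q ^ m) = poch (X * \<gamma>) m / Q (X * \<gamma>)"
        using Q_split[of "X * \<gamma>" m] xg Q_nonzero_shift[OF xg, of m] by (simp add: field_simps)
      have "R m * (Q (X * q * q ^ m) / Q (X * \<gamma> * q ^ m)) = R m * Q (X * q * q ^ m) * (1 / Q (X * \<gamma> * q ^ m))"
        by simp
      thus ?thesis unfolding 1 2 Rm by (simp add: qpochs_def qpoch_nat mult_ac)
    qed
    thus ?thesis using has_sum_imp_sums[OF S'(2)] by simp
  qed
  hence "S' = Q (X * q) / Q (X * \<gamma>) * phi21 (X * \<gamma>) \<delta> (X * q) q \<beta>"
    unfolding phi21_def by (rule sums_cmult_eq) (use nz xg in simp)
  ultimately show ?thesis by simp
qed

text \<open>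
  By \<open>eps_Q_shift\<close> the terms are those of a \<open>\<^sub>2\<phi>\<^sub>1\<close> up to the constant \<open>Q w * Q \<delta>\<close>.  When
  this constant is zero, every term of the given series vanishes.
\<close>

lemma second_sum:
  assumes S: "((\<lambda>i. rho \<beta> i * x ^ i * (Q (w * q ^ i) * Q (\<delta> / q ^ i))) has_sum S) UNIV"
    and nz: "\<And>i. poch w i \<noteq> 0" and d: "\<delta> \<noteq> 0"
  shows "S = Q w * Q \<delta> * phi21 (q / \<delta>) \<beta> w q (x * \<delta>)"
proof (cases "Q w * Q \<delta> = 0")
  case True
  have z: "rho \<beta> i * x ^ i * (Q (w * q ^ i) * Q (\<delta> / q ^ i)) = 0" for i
    using True Q_split[of w i] nz[of i] eps_Q_shift[of i 1 \<delta>] eps_nonzero by auto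
  have "S = 0" by (rule has_sum_unique[OF S has_sum_0]) (rule z)
  thus ?thesis using True by simp
next
  case False
  have "rho \<beta> i * x ^ i * (Q (w * q ^ i) * Q (\<delta> / q ^ i)) =
     Q w * Q \<delta> * (qpochs [q / \<delta>, \<beta>] q (int i) / qpochs [q, w] q (int i) * (x * \<delta>) ^ i)" for i
  proof -
    have 1: "Q (w * q ^ i) = Q w / poch w i"
      using Q_split[of w i] nz[of i] by simp
    have "(\<Prod>j<i. x * \<delta> - x * q * q ^ j) = (x * \<delta>) ^ i * poch (q / \<delta>) i"
      using d by (induction i) (simp_all add: poch_Suc field_simps)
    hence 2: "eps i * q ^ i * x ^ i * Q (\<delta> / q ^ i) = Q \<delta> * ((x * \<delta>) ^ i * poch (q / \<delta>) i / poch q i)"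
      unfolding eps_Q_shift by simp
    have "rho \<beta> i * x ^ i * (Q (w * q ^ i) * Q (\<delta> / q ^ i)) = poch \<beta> i * (eps i * q ^ i * x ^ i * Q (\<delta> / q ^ i)) * Q (w * q ^ i)"
      by (simp add: rho_def)
    thus ?thesis unfolding 2 1 by (simp add: qpochs_def qpoch_nat mult_ac)
  qed
  with has_sum_imp_sums[OF S] have "(\<lambda>i. Q w * Q \<delta> * (qpochs [q / \<delta>, \<beta>] q (int i) / qpochs [q, w] q (int i) * (x * \<delta>) ^ i)) sums S"
    by simp
  thus ?thesis unfolding phi21_def by (rule sums_cmult_eq) (use False in simp)
qed

lemma qpoch_eq_tau:
  assumes "a \<noteq> 0" "Q (q / a) \<noteq> 0"
  shows "qpoch a q k = tau k * a powi k * Q (q / a * q powi (- k)) / Q (q / a)"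
proof (cases k rule: int_cases2)
  case (nonneg n)
  have "Q (q / a * q powi (- int n)) = Q (q / a) * ((- 1 / a) ^ n / q ^ (n choose 2) * poch a n)"
    using Q_shift_neg[of "q / a" n] assms by simp
  thus ?thesis unfolding nonneg qpoch_nat using assms
    by (simp add: tau_nat power_divide) (simp add: mult_ac flip: power_mult_distrib)
next
  case (nonpos n)
  have "Q (q / a * q ^ n) = Q (q / a) / poch (q / a) n"
    using Q_split[of "q / a" n] poch_nonzero[OF assms(2), of n] by simp
  moreover have "(- q / a) ^ n = (- 1) ^ n * q ^ n / a ^ n"
    by (metis mult_minus1 power_divide power_mult_distrib)
  ultimately show ?thesis unfolding nonpos qpoch_neg[OF assms(1)] tau_uminus tau_nat powi_neg using assms
    by simp
qed

text \<open>
  Valid also where \<open>qpoch c q k\<close> has a pole: both sides are then zero.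
\<close>

lemma inverse_qpoch:
  assumes "Q c \<noteq> 0"
  shows "1 / qpoch c q k = Q (c * q powi k) / Q c"
proof (cases k rule: int_cases2)
  case (nonneg n)
  thus ?thesis
    using Q_split[of c n] assms poch_nonzero[OF assms, of n] by (simp add: qpoch_nat)
next
  case (nonpos n)
  have "c * q powi (- int n) * q ^ n = c" by (simp add: power_int_minus)
  hence "Q (c * q powi (- int n)) = Q c * (\<Prod>k<n. 1 - c * q powi (- int n) * q ^ k)"
    using qpoch_inf_split[OF q_lt_1, of "c * q powi (- int n)" n] by metis
  moreover have "1 / qpoch c q (- int n) = (\<Prod>k<n. 1 - c * q powi (- int n) * q ^ k)"
    by (cases "n = 0") (simp_all add: qpoch_def)
  ultimately show ?thesis using assms nonpos by simp
qed

lemma psi22_term: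
  assumes "a \<noteq> 0" "d \<noteq> 0" "Q (q / a) \<noteq> 0" "Q (q / d) \<noteq> 0" "Q c \<noteq> 0"
  shows "qpochs [a, b] q k / qpochs [c, d] q k * z powi k =
    Q (q / d) / (Q (q / a) * Q c) * (psi_coeff b (q / d) k * (a * z / d) powi k
      * (Q (c * q powi k) * Q (q / a * q powi (- k))))"
proof -
  have "qpochs [a, b] q k / qpochs [c, d] q k * z powi k
     = qpoch a q k / qpoch d q k * z powi k * qpoch b q k * (1 / qpoch c q k)"
    by (simp add: qpochs_def mult_ac)
  also have "qpoch a q k / qpoch d q k * z powi k =
     Q (q / d) / Q (q / a) * (a * z / d) powi k * Q (q / a * q powi (- k)) / Q (q / d * q powi (- k))"
    unfolding qpoch_eq_tau[OF assms(1,3)] qpoch_eq_tau[OF assms(2,4)] using assms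
    by (simp add: power_int_mult_distrib power_int_divide_distrib mult_ac)
  finally show ?thesis unfolding inverse_qpoch[OF assms(5)] by (simp add: psi_coeff_def mult_ac)
qed

end

theorem theorem2p1:
  fixes q a b c d z :: complex
  assumes "0 < norm q" and "norm q < 1"
    and "norm (c * d / (a * b)) < norm z" and "norm z < 1"
    and "norm (b * q / d) < 1"
    and "a \<noteq> 0" and "b \<noteq> 0" and "d \<noteq> 0"
    and "qpochs_inf [c, a * z / d, q / a, q / b, c * d / (a * b * z)] q \<noteq> 0"
    and "qpochs_inf [d / q, c, b * q / d, a * z / d, d * q / (a * z), q\<^sup>2 / d, q / a] q \<noteq> 0"
    and "\<And>k::nat. qpochs [q, d * q / (a * z)] q (int k) \<noteq> 0"
    and "\<And>k::nat. qpochs [q, c * q / d] q (int k) \<noteq> 0"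
  shows "psi22 a b c d q z =
      qpochs_inf [c / b, a * b * z / d, d * q / (a * b * z), q / d, q] q
        / qpochs_inf [c, a * z / d, q / a, q / b, c * d / (a * b * z)] q
        * phi21 (c * d / (a * b * z)) (d / a) (d * q / (a * z)) q (b * q / d)
    - qpochs_inf [c * q / d, b, d / a, a * z / q, q\<^sup>2 / (a * z), q / d, q] q
        / qpochs_inf [d / q, c, b * q / d, a * z / d, d * q / (a * z), q\<^sup>2 / d, q / a] q
        * phi21 (a * q / d) (b * q / d) (c * q / d) q z"
proof -
  interpret nome q using assms(1,2) by unfold_locales auto
  define p x v where "p = q / d" and "x = a * z / d" and "v = q / a"
  have z0: "z \<noteq> 0" using assms(3) by auto
  have p0: "p \<noteq> 0" and x0: "x \<noteq> 0" and v0: "v \<noteq> 0"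
    using assms z0 by (auto simp: p_def x_def v_def)
  have nz: "Q c \<noteq> 0" "Q x \<noteq> 0" "Q v \<noteq> 0" "Q (q / b) \<noteq> 0" "Q (c * d / (a * b * z)) \<noteq> 0"
      "Q (d / q) \<noteq> 0" "Q (b * q / d) \<noteq> 0" "Q (d * q / (a * z)) \<noteq> 0" "Q (q\<^sup>2 / d) \<noteq> 0"
    using assms(9,10) by (auto simp: qpochs_inf_def x_def v_def)
  have dq: "d / q \<noteq> 1" using nz(6) one_minus_shift_nonzero[OF nz(6), of 0] by auto
  have Qp: "Q p = (1 - q / d) * Q (q\<^sup>2 / d)"
    using Q_step[of p] by (simp add: p_def power2_eq_square)
  have Qdq: "Q (d / q) = (1 - d / q) * Q d"
    using Q_step[of "d / q"] by simp
  have d0: "Q d \<noteq> 0" using nz(6) Qdq by auto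
  \<comment> \<open>The denominators keep \<open>d\<close> away from all integer powers of \<open>q\<close>.\<close>
  have p_nz: "Q p \<noteq> 0" using nz(9) dq assms(8) by (auto simp: Qp field_simps)
  have tp: "theta p \<noteq> 0"
    using theta_nonzero_iff[OF p0] p_nz d0 by (simp add: p_def)
  have qx: "q / x = d * q / (a * z)" by (simp add: x_def mult.commute)
  have tx: "theta x \<noteq> 0"
    using theta_nonzero_iff[OF x0] nz by (simp add: qx)
  have bp: "b * p = b * q / d" by (simp add: p_def)
  have bp0: "Q (b * p) \<noteq> 0" using nz by (simp add: bp)
  have xvp: "x * v / p = z" using assms z0 by (simp add: x_def v_def p_def)
  have cbx: "c / (b * x) = c * d / (a * b * z)" by (simp add: x_def mult_ac)
  have sm: "norm (x * v / p) < 1" "norm (c / (b * x)) < 1"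
  proof -
    have "c / (b * x) = c * d / (a * b) / z" by (simp add: cbx)
    hence "norm (c / (b * x)) = norm (c * d / (a * b)) / norm z" by (simp only: norm_divide)
    thus "norm (c / (b * x)) < 1" using assms(3) z0 by simp
  qed (use assms(4) in \<open>simp only: xvp\<close>)
  obtain S1 S2 where
    S1: "((\<lambda>i. rho (b * p) i * (1 / x) ^ i * (Q (c / b / q ^ i) * Q (b * v * q ^ i))) has_sum S1) UNIV" and
    S2: "((\<lambda>i. rho (b * p) i * x ^ i * (Q (c * p * q ^ i) * Q (v / p / q ^ i))) has_sum S2) UNIV" and
    S: "((\<lambda>k. psi_coeff b p k * x powi k * (Q (c * q powi k) * Q (v * q powi (- k)))) has_sum
      (Q q / Q (q / b) * theta (b * x) / theta x / Q (b * p) * S1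
       - Q b * Q q ^ 2 / theta p * x * theta (p / x) / theta x / Q (b * p) * S2)) UNIV"
    using psi_product_sum[OF assms(7) p0 x0 nz(4) tp bp0 tx sm] by blast
  have vp: "v / p = d / a" using assms by (simp add: v_def p_def)
  have e1: "1 / x * q = d * q / (a * z)" by (simp add: x_def)
  have e2: "1 / x * (c / b) = c * d / (a * b * z)" by (simp add: x_def mult_ac)
  have "b * v = b * p * (d / a)" using assms by (simp add: v_def p_def)
  hence S1': "S1 = Q (c / b) * Q (b * p) * Q (d * q / (a * z)) / Q (c * d / (a * b * z))
      * phi21 (c * d / (a * b * z)) (d / a) (d * q / (a * z)) q (b * q / d)"
    using heine_sum[of "1 / x" "c / b" "b * p" "d / a" S1, unfolded e1 e2] S1 nz sm(2) assms(5)
    by (simp add: cbx bp)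
  have cp: "c * p = c * q / d" by (simp add: p_def)
  have cnz: "poch (c * q / d) i \<noteq> 0" for i
    using assms(12)[of i] by (simp add: qpochs_def qpoch_nat)
  have S2': "S2 = Q (c * q / d) * Q (d / a) * phi21 (a * q / d) (b * q / d) (c * q / d) q z"
    using second_sum[of "b * p" x "c * q / d" "d / a" S2] S2 cnz assms z0
    unfolding vp cp bp by (simp add: x_def mult.commute)
  define K where "K = Q p / (Q v * Q c)"
  have "psi22 a b c d q z = K * (Q q / Q (q / b) * theta (b * x) / theta x / Q (b * p) * S1
       - Q b * Q q ^ 2 / theta p * x * theta (p / x) / theta x / Q (b * p) * S2)"
    unfolding psi22_def K_def
    using has_sum_cmult_right[OF S, of "Q p / (Q v * Q c)"] psi22_term[OF assms(6,8), of c b] nz p_nz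
    unfolding p_def x_def v_def by (intro infsumI) simp
  also have "\<dots> = K * (Q q / Q (q / b) * theta (b * x) / theta x / Q (b * p)) * S1
     - K * (Q b * Q q ^ 2 / theta p * x * theta (p / x) / theta x / Q (b * p)) * S2"
    by (simp add: algebra_simps)
  also have "K * (Q q / Q (q / b) * theta (b * x) / theta x / Q (b * p)) * S1 =
      qpochs_inf [c / b, a * b * z / d, d * q / (a * b * z), q / d, q] q
        / qpochs_inf [c, a * z / d, q / a, q / b, c * d / (a * b * z)] q
        * phi21 (c * d / (a * b * z)) (d / a) (d * q / (a * z)) q (b * q / d)"
  proof -
    have e: "q / (b * x) = d * q / (a * b * z)" "b * x = a * b * z / d" by (simp_all add: x_def mult_ac)
    have bx0: "b * x \<noteq> 0" using assms(7) x0 by simp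
    have t: "theta (b * x) = Q q * Q (a * b * z / d) * Q (d * q / (a * b * z))"
      using jacobi_triple[OF bx0] unfolding e(1) unfolding e(2) .
    have t': "theta x = Q q * Q x * Q (d * q / (a * z))"
      using jacobi_triple[OF x0] by (simp add: qx)
    show ?thesis unfolding S1' t t' K_def qpochs_inf_def using nz bp0
      by (simp add: x_def[symmetric] v_def[symmetric] p_def[symmetric] mult_ac)
  qed
  also have "K * (Q b * Q q ^ 2 / theta p * x * theta (p / x) / theta x / Q (b * p)) * S2 =
     qpochs_inf [c * q / d, b, d / a, a * z / q, q\<^sup>2 / (a * z), q / d, q] q
        / qpochs_inf [d / q, c, b * q / d, a * z / d, d * q / (a * z), q\<^sup>2 / d, q / a] q
        * phi21 (a * q / d) (b * q / d) (c * q / d) q z"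
  proof -
    define A where "A = a * z"
    have A0: "A \<noteq> 0" using assms z0 by (simp add: A_def)
    have "p / x = q / A" "q / (p / x) = A" using assms z0 by (simp_all add: p_def x_def A_def)
    hence t: "theta (p / x) = Q q * Q (q / A) * Q A"
      using jacobi_triple[of "p / x"] p0 x0 A0 by simp
    have t': "theta x = Q q * Q x * Q (d * q / A)"
      using jacobi_triple[OF x0] by (simp add: qx A_def)
    have t'': "theta p = Q q * Q p * Q d"
      using jacobi_triple[OF p0] by (simp add: p_def)
    have a1: "Q (A / q) = (1 - A / q) * Q A"
      using Q_step[of "A / q"] by simp
    have a2: "Q (q / A) = (1 - q / A) * Q (q\<^sup>2 / A)"
      using Q_step[of "q / A"] by (simp add: power2_eq_square)
    \<comment> \<open>The factors \<open>A / q, q\<^sup>2 / A\<close> and \<open>d / q, q\<^sup>2 / d\<close> come from \<open>theta (A / q)\<close> and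
      \<open>theta (d / q)\<close>; one theta shift each brings them to \<open>A, q / A\<close> and \<open>d, q / d\<close>.\<close>
    have flipA: "Q (A / q) * Q (q\<^sup>2 / A) = - (A / q) * (Q A * Q (q / A))"
      unfolding a1 a2 using A0 by (simp add: field_simps)
    have flipd: "Q (d / q) * Q (q\<^sup>2 / d) = - (d / q) * (Q d * Q p)"
      unfolding Qdq Qp using assms(8) by (simp add: field_simps)
    have "qpochs_inf [c * q / d, b, d / a, A / q, q\<^sup>2 / A, q / d, q] q
        / qpochs_inf [d / q, c, b * q / d, x, d * q / A, q\<^sup>2 / d, q / a] q
      = Q (c * q / d) * Q b * Q (d / a) * Q p * Q q * (Q (A / q) * Q (q\<^sup>2 / A))
        / (Q c * Q (b * p) * Q x * Q (d * q / A) * Q v * (Q (d / q) * Q (q\<^sup>2 / d)))"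
      by (simp add: qpochs_inf_def p_def v_def mult_ac)
    also have "\<dots> = Q (c * q / d) * Q b * Q (d / a) * Q q * x * (Q A * Q (q / A))
        / (Q c * Q (b * p) * Q x * Q (d * q / A) * Q v * Q d)"
      unfolding flipA flipd using p_nz d0 assms(8) by (simp add: x_def A_def field_simps)
    also have "\<dots> = K * (Q b * Q q ^ 2 / theta p * x * theta (p / x) / theta x / Q (b * p)) * (Q (c * q / d) * Q (d / a))"
      unfolding t t' t'' K_def using p_nz by (simp add: power2_eq_square mult_ac)
    finally show ?thesis unfolding S2' A_def x_def by simp
  qed
  finally show ?thesis .
qed

end
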